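(* Let $n\ge1$, let $I\subset\mathbb{R}$ be an interval, and let $a_{ij}$ ($i,j=1,\dots,n$), $\mathbf{b}=(b_1,\dots,b_n)$ and $c$ be real-valued measurable coefficients on $\mathbb{R}^n\times I$ satisfying the following. (1) $a_{ij}\in C^{1,0}(\mathbb{R}^n\times I)$, $a_{ij}=a_{ji}$ for $i,j=1,\dots,n$, and there is $\lambda>0$ with $\sum_{i,j=1}^n a_{ij}(x,t)\xi_i\xi_j\ge\lambda|\xi|^2$ for all $\xi\in\mathbb{R}^n$, $x\in\mathbb{R}^n$, $t\in I$; moreover $|a_{ij}(x,t)|=O(|x|^2)$ and $|\partial_i a_{ij}(x,t)|=O(|x|)$ as $|x|\to\infty$, locally uniformly in $t\in I$. (2) $\mathbf{b}\in C^{1,0}(\mathbb{R}^n\times I)$ and $\mathbf{b}(x,t)=O(|x|)$ as $|x|\to\infty$, locally uniformly in $t\in I$. Let $u\in C^{2,1}(\mathbb{R}^n\times I)$ be a solution of $$\partial_t u-\sum_{i,j=1}^n\partial_i\big(a_{ij}(x,t)\partial_j u\big)+\mathbf{b}(x,t)\cdot\nabla u+c(x,t)u=0,\quad x\in\mathbb{R}^n,\ t\in I,$$ satisfying $u\in L^q(\mathbb{R}^n\times I)$ for some $q\in[2,\infty)$. Then the energy identity $$\int_{\mathbb{R}^n}|u(x,t)|^q\,dx+q(q-1)\int_s^t\int_{\mathbb{R}^n}|u(x,\tau)|^{q-2}\sum_{i,j=1}^n a_{ij}(x,\tau)\,\partial_iu(x,\tau)\,\partial_ju(x,\tau)\,dx\,d\tau$$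 $$+\int_s^t\int_{\mathbb{R}^n}\big(-\operatorname{div}\mathbf{b}(x,\tau)+q\,c(x,\tau)\big)|u(x,\tau)|^q\,dx\,d\tau=\int_{\mathbb{R}^n}|u(x,s)|^q\,dx$$ holds for all $s,t\in I$ with $s\le t$.
   Context: Functions are real-valued. $C^{k,l}(\mathbb{R}^n\times I)$ denotes functions that are $C^k$ in $x$ and $C^l$ in $t$ (the corresponding derivatives being continuous on $\mathbb{R}^n\times I$). $\partial_i=\partial/\partial x_i$; $\nabla$ and $\operatorname{div}\mathbf{b}=\sum_{j=1}^n\partial_{x_j}b_j$ are taken with respect to $x$ only.
   Formalization: As c and div b are unbounded, the integrals may be infinite or undefined; the identity is proved in [0,∞] with the negative part of (-div b+qc)|u|^q moved to the right, and literally, with all integrals convergent, when that part's integral and ∫|u(x,s)|^q dx are finite. *)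

theory Defs
  imports "HOL-Analysis.Analysis" "HOL-Library.Landau_Symbols"
begin

text \<open>Functions on $R^n \times I$ are curried and total in \<open>t\<close>; only their values at
  \<open>t \<in> I\<close> matter.\<close>

definition pdx :: "'n::finite \<Rightarrow> (real^'n \<Rightarrow> real \<Rightarrow> real) \<Rightarrow> real^'n \<Rightarrow> real \<Rightarrow> real" where
  "pdx i f x t = deriv (\<lambda>h. f (x + h *\<^sub>R axis i 1) t) 0"

text \<open>The derivative is taken within \<open>I\<close>, hence one-sided at end points belonging to \<open>I\<close>.\<close>

definition pdt :: "real set \<Rightarrow> (real^'n \<Rightarrow> real \<Rightarrow> real) \<Rightarrow> real^'n \<Rightarrow> real \<Rightarrow> real" where
  "pdt I f x t = vector_derivative (\<lambda>\<tau>. f x \<tau>) (at t within I)"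

definition grad :: "(real^'n::finite \<Rightarrow> real \<Rightarrow> real) \<Rightarrow> real^'n \<Rightarrow> real \<Rightarrow> real^'n" where
  "grad f x t = (\<chi> i. pdx i f x t)"

definition divergence :: "(real^'n::finite \<Rightarrow> real \<Rightarrow> real^'n) \<Rightarrow> real^'n \<Rightarrow> real \<Rightarrow> real" where
  "divergence b x t = (\<Sum>j\<in>UNIV. pdx j (\<lambda>x t. b x t $ j) x t)"

primrec Cx :: "nat \<Rightarrow> real set \<Rightarrow> (real^'n::finite \<Rightarrow> real \<Rightarrow> real) \<Rightarrow> bool" where
  "Cx 0 I f \<longleftrightarrow> continuous_on (UNIV \<times> I) (\<lambda>(x, t). f x t)"
| "Cx (Suc k) I f \<longleftrightarrow> continuous_on (UNIV \<times> I) (\<lambda>(x, t). f x t) \<and>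
     (\<forall>i. (\<forall>x. \<forall>t\<in>I. (\<lambda>h. f (x + h *\<^sub>R axis i 1) t) differentiable (at 0)) \<and> Cx k I (pdx i f))"

primrec Ct :: "nat \<Rightarrow> real set \<Rightarrow> (real^'n \<Rightarrow> real \<Rightarrow> real) \<Rightarrow> bool" where
  "Ct 0 I f \<longleftrightarrow> continuous_on (UNIV \<times> I) (\<lambda>(x, t). f x t)"
| "Ct (Suc l) I f \<longleftrightarrow> continuous_on (UNIV \<times> I) (\<lambda>(x, t). f x t) \<and>
     (\<forall>x. \<forall>t\<in>I. (\<lambda>\<tau>. f x \<tau>) differentiable (at t within I)) \<and> Ct l I (pdt I f)"

text \<open>The space $C^{k,l}(R^n \times I)$: pure space derivatives up to order \<open>k\<close> and pure time
  derivatives up to order \<open>l\<close> are jointly continuous; no mixed space-time derivatives are required.\<close>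

definition Ckl :: "nat \<Rightarrow> nat \<Rightarrow> real set \<Rightarrow> (real^'n::finite \<Rightarrow> real \<Rightarrow> real) \<Rightarrow> bool" where
  "Ckl k l I f \<longleftrightarrow> Cx k I f \<and> Ct l I f"

text \<open>\<open>f(x,t) = O(|x|\<^sup>k)\<close> as \<open>|x| \<rightarrow> \<infinity>\<close>, locally uniformly in \<open>t \<in> I\<close> (uniformly on compact subsets
  of \<open>I\<close>).\<close>

definition growth_O :: "real set \<Rightarrow> nat \<Rightarrow> (real^'n::finite \<Rightarrow> real \<Rightarrow> 'b::real_normed_vector) \<Rightarrow> bool" where
  "growth_O I k f \<longleftrightarrow> (\<forall>K. compact K \<and> K \<subseteq> I \<longrightarrow>
     (\<lambda>(x, t). norm (f x t)) \<in> O[at_infinity \<times>\<^sub>F principal K](\<lambda>(x, t). norm x ^ k))"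

definition in_Lp :: "real \<Rightarrow> 'a::euclidean_space set \<Rightarrow> ('a \<Rightarrow> real) \<Rightarrow> bool" where
  "in_Lp p S f \<longleftrightarrow> f \<in> borel_measurable (lebesgue_on S) \<and>
     integrable (lebesgue_on S) (\<lambda>z. \<bar>f z\<bar> powr p)"

text \<open>\<open>|y|\<^sup>r\<close> with the convention \<open>|y|\<^sup>0 = 1\<close> also for \<open>y = 0\<close>, whereas \<open>0 powr 0 = 0\<close>.\<close>

definition abs_pow :: "real \<Rightarrow> real \<Rightarrow> real" where
  "abs_pow y r = (if r = 0 then 1 else \<bar>y\<bar> powr r)"

definition gradient_density ::
  "real \<Rightarrow> (real^'n::finite \<Rightarrow> real \<Rightarrow> real^'n^'n) \<Rightarrow> (real^'n \<Rightarrow> real \<Rightarrow> real) \<Rightarrow> real^'n \<Rightarrow> real \<Rightarrow> real" where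
  "gradient_density q a u x t = abs_pow (u x t) (q - 2) *
     (\<Sum>i\<in>UNIV. \<Sum>j\<in>UNIV. a x t $ i $ j * pdx i u x t * pdx j u x t)"

definition lower_order_density ::
  "real \<Rightarrow> (real^'n::finite \<Rightarrow> real \<Rightarrow> real^'n) \<Rightarrow> (real^'n \<Rightarrow> real \<Rightarrow> real) \<Rightarrow>
   (real^'n \<Rightarrow> real \<Rightarrow> real) \<Rightarrow> real^'n \<Rightarrow> real \<Rightarrow> real" where
  "lower_order_density q b c u x t = (- divergence b x t + q * c x t) * \<bar>u x t\<bar> powr q"

text \<open>Since no bound on \<open>c\<close> or on the divergence of \<open>b\<close> is assumed, the integrals in the energy
  identity may be infinite. \<open>energy_identity_ext\<close> is the identity in \<open>[0,\<infinity>]\<close>, where the integral of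
  the signed lower order density is the difference of the integrals of its positive and negative
  parts, the latter moved to the right-hand side to avoid \<open>\<infinity> - \<infinity>\<close>. Here \<open>ennreal\<close> truncates
  negative reals to \<open>0\<close>, so it takes positive parts.\<close>

definition energy_identity_ext ::
  "real \<Rightarrow> (real^'n::finite \<Rightarrow> real \<Rightarrow> real^'n^'n) \<Rightarrow> (real^'n \<Rightarrow> real \<Rightarrow> real^'n) \<Rightarrow>
   (real^'n \<Rightarrow> real \<Rightarrow> real) \<Rightarrow> (real^'n \<Rightarrow> real \<Rightarrow> real) \<Rightarrow> real \<Rightarrow> real \<Rightarrow> bool" where
  "energy_identity_ext q a b c u s t \<longleftrightarrow>
     (\<integral>\<^sup>+x. ennreal (\<bar>u x t\<bar> powr q) \<partial>lborel)
     + ennreal (q * (q - 1)) *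
         (\<integral>\<^sup>+\<tau>\<in>{s..t}. (\<integral>\<^sup>+x. ennreal (gradient_density q a u x \<tau>) \<partial>lborel) \<partial>lborel)
     + (\<integral>\<^sup>+\<tau>\<in>{s..t}. (\<integral>\<^sup>+x. ennreal (lower_order_density q b c u x \<tau>) \<partial>lborel) \<partial>lborel)
     = (\<integral>\<^sup>+x. ennreal (\<bar>u x s\<bar> powr q) \<partial>lborel)
     + (\<integral>\<^sup>+\<tau>\<in>{s..t}. (\<integral>\<^sup>+x. ennreal (- lower_order_density q b c u x \<tau>) \<partial>lborel) \<partial>lborel)"

text \<open>The energy identity between finite Lebesgue integrals, including absolute convergence of all
  the integrals involved.\<close>

definition energy_identity_finite ::
  "real \<Rightarrow> (real^'n::finite \<Rightarrow> real \<Rightarrow> real^'n^'n) \<Rightarrow> (real^'n \<Rightarrow> real \<Rightarrow> real^'n) \<Rightarrow>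
   (real^'n \<Rightarrow> real \<Rightarrow> real) \<Rightarrow> (real^'n \<Rightarrow> real \<Rightarrow> real) \<Rightarrow> real \<Rightarrow> real \<Rightarrow> bool" where
  "energy_identity_finite q a b c u s t \<longleftrightarrow>
     integrable lborel (\<lambda>x. \<bar>u x t\<bar> powr q) \<and>
     integrable lborel (\<lambda>x. \<bar>u x s\<bar> powr q) \<and>
     set_integrable lborel (UNIV \<times> {s..t}) (\<lambda>(x, \<tau>). gradient_density q a u x \<tau>) \<and>
     set_integrable lborel (UNIV \<times> {s..t}) (\<lambda>(x, \<tau>). lower_order_density q b c u x \<tau>) \<and>
     (LBINT x. \<bar>u x t\<bar> powr q)
     + q * (q - 1) * (LBINT \<tau>:{s..t}. (LBINT x. gradient_density q a u x \<tau>))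
     + (LBINT \<tau>:{s..t}. (LBINT x. lower_order_density q b c u x \<tau>))
     = (LBINT x. \<bar>u x s\<bar> powr q)"

end

theory Submission
  imports Defs
begin

text \<open>
  Multiply the equation by \<open>q |u|\<^sup>q\<^sup>-\<^sup>2 u\<close> and by a cutoff \<open>\<eta>\<close> with compact support in \<open>x\<close>. Both
  \<open>|u|\<^sup>q\<^sup>-\<^sup>2 u\<close> and \<open>|u|\<^sup>q\<close> are continuously differentiable functions of \<open>u\<close> because \<open>q \<ge> 2\<close>, so the
  product rule and the symmetry of \<open>a\<close> give the pointwise balance law
  \<open>\<partial>\<^sub>t (\<eta> |u|\<^sup>q) = div F + |u|\<^sup>q (div (a \<nabla>\<eta>) + b \<bullet> \<nabla>\<eta>) - \<eta> (q (q - 1) G + L)\<close>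
  with \<open>F = q \<eta> |u|\<^sup>q\<^sup>-\<^sup>2 u a \<nabla>u - |u|\<^sup>q a \<nabla>\<eta> - \<eta> |u|\<^sup>q b\<close>, where \<open>G\<close> is the gradient density and \<open>L\<close> the lower
  order density (\<open>energy_balance_algebra\<close>). The cross term
  \<open>- a \<nabla>(|u|\<^sup>q) \<bullet> \<nabla>\<eta>\<close> has been integrated by parts once more, so no gradient of \<open>u\<close> occurs in the error.
  Since \<open>F\<close> has compact support, its divergence
  integrates to zero, and integrating over \<open>[s, t]\<close> gives a localized energy identity
  (\<open>localized_energy_identity\<close>).

  The cutoff is \<open>\<eta>(x) = max 0 (1 - \<rho> |x|\<^sup>2)\<^sup>3\<close>. It is twice continuously differentiable, vanishes for
  \<open>\<rho> |x|\<^sup>2 \<ge> 1\<close>, and increases to \<open>1\<close> as \<open>\<rho>\<close> decreases to \<open>0\<close>. Its gradient and Hessian decay fast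
  enough on its support to compensate the growth \<open>a = O(|x|\<^sup>2)\<close>, \<open>\<partial>a = O(|x|)\<close>, \<open>b = O(|x|)\<close>,
  so \<open>div (a \<nabla>\<eta>) + b \<bullet> \<nabla>\<eta>\<close> is bounded uniformly in \<open>\<rho> \<le> 1\<close> and tends to \<open>0\<close> pointwise
  (\<open>cutoff_error_bounded\<close>, \<open>tendsto_cutoff_error\<close>). As \<open>|u|\<^sup>q\<close> is integrable, dominated convergence
  removes the error term, and monotone convergence in \<open>[0,\<infinity>]\<close> handles the remaining terms once the
  negative part of \<open>L\<close> has been moved to the right-hand side (\<open>energy_identity_strip\<close>). The identity
  between finite integrals follows by reading off real parts.

  The coefficient \<open>c\<close> is only measurable, but \<open>c u\<close> is continuous by the equation, hence so is
  \<open>L\<close>; this makes every localized integral finite (\<open>continuous_lower_order_density\<close>).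
\<close>

section \<open>Powers of the absolute value\<close>

lemma abs_pow_nonneg: "0 \<le> abs_pow y r"
  by (simp add: abs_pow_def)

lemma abs_powr_eq_abs_pow:
  assumes "0 \<le> p"
  shows "\<bar>y\<bar> powr (p + 2) = abs_pow y p * y * y"
proof (cases "y = 0")
  case False
  then have "\<bar>y\<bar> powr (p + 2) = \<bar>y\<bar> powr p * \<bar>y\<bar> powr 2"
    by (simp add: powr_add)
  then show ?thesis
    using False by (auto simp: abs_pow_def power2_eq_square)
qed (use assms in auto)

lemma continuous_abs_pow:
  assumes "0 \<le> p"
  shows "continuous_on UNIV (\<lambda>y. abs_pow y p)"
proof (cases "p = 0")
  case False
  then have "continuous_on UNIV (\<lambda>y::real. \<bar>y\<bar> powr p)"
    using assms by (intro continuous_on_powr' continuous_on_rabs continuous_on_id continuous_on_const) auto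
  then show ?thesis using False by (simp add: abs_pow_def)
qed (simp add: abs_pow_def)

text \<open>Away from \<open>0\<close> this is the power rule for \<open>y\<close> or \<open>- y\<close>. At \<open>0\<close> the difference quotient is
  \<open>abs_pow y p\<close> itself, which is continuous; for \<open>p = 0\<close> the convention \<open>abs_pow 0 0 = 1\<close> is what
  makes the formula correct there.\<close>

lemma has_derivative_abs_pow_times_self:
  assumes "0 \<le> p"
  shows "((\<lambda>y. abs_pow y p * y) has_real_derivative (p + 1) * abs_pow y p) (at y)"
proof -
  consider "p = 0" | "p > 0" "y = 0" | "p > 0" "y > 0" | "p > 0" "y < 0"
    using assms by linarith
  then show ?thesis
  proof cases
    case 1
    then show ?thesis by (simp add: abs_pow_def)
  next
    case 2
    have "isCont (\<lambda>y. abs_pow y p) 0"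
      using continuous_abs_pow[OF assms] by (simp add: continuous_on_eq_continuous_at)
    then have "((\<lambda>y. abs_pow y p) \<longlongrightarrow> 0) (at 0)"
      using 2 by (simp add: isCont_def abs_pow_def)
    then have "((\<lambda>y. (abs_pow y p * y - 0) / (y - 0)) \<longlongrightarrow> 0) (at 0)"
      by (rule Lim_transform_eventually) (simp add: eventually_at_filter)
    then show ?thesis
      using 2 by (simp add: has_field_derivative_iff abs_pow_def)
  next
    case 3
    have "((\<lambda>y. y powr p * y) has_real_derivative (p + 1) * y powr p) (at y)"
      using 3 by (auto intro!: derivative_eq_intros simp: powr_diff field_simps)
    then have "((\<lambda>y. abs_pow y p * y) has_real_derivative (p + 1) * y powr p) (at y)"
      by (rule has_field_derivative_transform_within_open[of _ _ _ "{0<..}"])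
         (use 3 in \<open>auto simp: abs_pow_def\<close>)
    then show ?thesis using 3 by (simp add: abs_pow_def)
  next
    case 4
    have "((\<lambda>y. (- y) powr p * y) has_real_derivative (p + 1) * (- y) powr p) (at y)"
      using 4 by (auto intro!: derivative_eq_intros simp: powr_diff field_simps)
    then have "((\<lambda>y. abs_pow y p * y) has_real_derivative (p + 1) * (- y) powr p) (at y)"
      by (rule has_field_derivative_transform_within_open[of _ _ _ "{..<0}"])
         (use 4 in \<open>auto simp: abs_pow_def\<close>)
    then show ?thesis using 4 by (simp add: abs_pow_def)
  qed
qed

lemma has_derivative_abs_powr:
  assumes "0 \<le> p"
  shows "((\<lambda>y. \<bar>y\<bar> powr (p + 2)) has_real_derivative (p + 2) * (abs_pow y p * y)) (at y)"
proof -
  have "((\<lambda>y. abs_pow y p * y * y) has_real_derivative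
      (p + 1) * abs_pow y p * y + 1 * (abs_pow y p * y)) (at y)"
    by (rule DERIV_mult[OF has_derivative_abs_pow_times_self[OF assms] DERIV_ident])
  then show ?thesis
    by (simp add: abs_powr_eq_abs_pow[OF assms] algebra_simps)
qed

section \<open>Partial derivatives\<close>

definition has_partial :: "'n::finite \<Rightarrow> (real^'n \<Rightarrow> real) \<Rightarrow> real^'n \<Rightarrow> real \<Rightarrow> bool" where
  "has_partial i f x d \<longleftrightarrow> ((\<lambda>h. f (x + h *\<^sub>R axis i 1)) has_real_derivative d) (at 0)"

text \<open>\<open>pdx\<close> is a total function and says nothing about differentiability, so the calculus is done
  with the relation \<open>has_partial\<close> and translated at the end.\<close>

lemma pdx_eqI: "has_partial i (\<lambda>y. f y t) x d \<Longrightarrow> pdx i f x t = d"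
  by (simp add: has_partial_def pdx_def DERIV_imp_deriv)

lemma has_partial_pdxI:
  "(\<lambda>h. f (x + h *\<^sub>R axis i 1) t) differentiable (at 0) \<Longrightarrow> has_partial i (\<lambda>y. f y t) x (pdx i f x t)"
  by (simp add: has_partial_def pdx_def DERIV_deriv_iff_real_differentiable)

lemma has_partial_diff:
  "has_partial i f x d \<Longrightarrow> has_partial i g x e \<Longrightarrow> has_partial i (\<lambda>y. f y - g y) x (d - e)"
  unfolding has_partial_def by (rule DERIV_diff)

lemma has_partial_mult:
  "has_partial i f x d \<Longrightarrow> has_partial i g x e \<Longrightarrow> has_partial i (\<lambda>y. f y * g y) x (d * g x + f x * e)"
  unfolding has_partial_def by (drule (1) DERIV_mult) (simp add: ac_simps)

lemma has_partial_const: "has_partial i (\<lambda>y. k) x 0"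
  unfolding has_partial_def by simp

lemma has_partial_sum:
  "(\<And>j. j \<in> J \<Longrightarrow> has_partial i (f j) x (d j)) \<Longrightarrow>
   has_partial i (\<lambda>y. \<Sum>j\<in>J. f j y) x (\<Sum>j\<in>J. d j)"
  unfolding has_partial_def by (rule DERIV_sum) auto

lemma has_partial_compose:
  assumes "(g has_real_derivative e) (at (f x))" "has_partial i f x d"
  shows "has_partial i (\<lambda>y. g (f y)) x (e * d)"
  unfolding has_partial_def
  by (rule DERIV_chain2) (use assms in \<open>auto simp: has_partial_def\<close>)

lemma has_partial_component: "has_partial i (\<lambda>y. y $ j) x (if i = j then 1 else 0)"
  unfolding has_partial_def
  by (auto simp: axis_def intro!: derivative_eq_intros)

lemma has_partial_norm_square:
  "has_partial i (\<lambda>y. (norm y)\<^sup>2) x (2 * x $ i)"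
proof -
  have "has_partial i (\<lambda>y. \<Sum>j\<in>UNIV. y $ j * y $ j) x
          (\<Sum>j\<in>UNIV. (if i = j then 1 else 0) * x $ j + x $ j * (if i = j then 1 else 0))"
    by (intro has_partial_sum has_partial_mult has_partial_component)
  also have "(\<Sum>j\<in>UNIV. (if i = j then 1 else 0) * x $ j + x $ j * (if i = j then 1 else 0))
      = 2 * x $ i"
    by (simp add: sum.distrib if_distrib[of "\<lambda>c. c * _"] if_distrib[of "\<lambda>c. _ * c"] cong: if_cong)
  also have "(\<lambda>y::real^'a. \<Sum>j\<in>UNIV. y $ j * y $ j) = (\<lambda>y. (norm y)\<^sup>2)"
    by (simp add: power2_norm_eq_inner inner_vec_def)
  finally show ?thesis .
qed

lemma has_partial_along_line:
  assumes "has_partial i f (x + h *\<^sub>R axis i 1) d"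
  shows "((\<lambda>h. f (x + h *\<^sub>R axis i 1)) has_real_derivative d) (at h)"
proof -
  have "((\<lambda>k. f (x + h *\<^sub>R axis i 1 + k *\<^sub>R axis i 1)) has_real_derivative d) (at 0)"
    using assms by (simp add: has_partial_def)
  moreover have "x + h *\<^sub>R axis i 1 + k *\<^sub>R axis i 1 = x + (k + h) *\<^sub>R axis i 1" for k
    by (simp add: scaleR_add_left)
  ultimately have "((\<lambda>k. f (x + (k + h) *\<^sub>R axis i 1)) has_real_derivative d) (at 0)"
    by (simp only:)
  then show ?thesis
    using DERIV_shift[of "\<lambda>h. f (x + h *\<^sub>R axis i 1)" d 0 h] by simp
qed

lemma integral_lborel_shift:
  fixes f :: "'a::euclidean_space \<Rightarrow> real"
  assumes "f \<in> borel_measurable borel"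
  shows "integral\<^sup>L lborel (\<lambda>x. f (x + v)) = integral\<^sup>L lborel f"
proof -
  have "integral\<^sup>L lborel f = integral\<^sup>L (distr lborel borel ((+) v)) f"
    by (simp add: lborel_distr_plus)
  also have "\<dots> = integral\<^sup>L lborel (\<lambda>x. f (v + x))"
    by (subst integral_distr) (use assms in auto)
  finally show ?thesis by (simp add: add.commute)
qed

lemma integrable_compact_support:
  fixes f :: "'a::euclidean_space \<Rightarrow> real"
  assumes "continuous_on S f" "compact S" "\<And>x. x \<notin> S \<Longrightarrow> f x = 0"
  shows "integrable lborel f"
proof -
  have "integrable lborel (\<lambda>x. indicator S x *\<^sub>R f x)"
    by (rule borel_integrable_compact) (use assms in auto)
  also have "(\<lambda>x. indicator S x *\<^sub>R f x) = f"
    using assms(3) by (auto simp: indicator_def fun_eq_iff)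
  finally show ?thesis .
qed

text \<open>The difference quotients of \<open>f\<close> in direction \<open>i\<close> have integral zero by translation invariance. By the
  mean value theorem they are dominated by a multiple of the indicator of a ball, so the integral
  passes to their limit \<open>f'\<close>.\<close>

lemma integral_partial_eq_zero:
  fixes f f' :: "real^'n::finite \<Rightarrow> real"
  assumes f': "\<And>x. has_partial i f x (f' x)"
    and cont: "continuous_on UNIV f" "continuous_on UNIV f'"
    and supp: "\<And>x. r < norm x \<Longrightarrow> f x = 0"
  shows "integral\<^sup>L lborel f' = 0"
proof -
  define e :: "real^'n" where "e = axis i 1"
  have e [simp]: "norm e = 1" by (simp add: e_def)
  have meas [measurable]: "f \<in> borel_measurable borel" "f' \<in> borel_measurable borel"
    using cont by (auto intro: borel_measurable_continuous_onI)
  have intf: "integrable lborel f"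
    by (rule integrable_compact_support[of "cball 0 r"])
       (use supp cont in \<open>auto intro: continuous_on_subset\<close>)
  have intfs: "integrable lborel (\<lambda>x. f (x + v))" for v
    by (rule integrable_compact_support[of "cball (- v) r"])
       (use supp in \<open>auto simp: dist_norm norm_minus_commute algebra_simps
          intro!: continuous_on_compose2[OF cont(1)] continuous_intros\<close>)
  define h where "h m = inverse (real (Suc m))" for m
  have h: "0 < h m" "h m \<le> 1" for m
    by (auto simp: h_def field_simps)
  define d where "d m x = (f (x + h m *\<^sub>R e) - f x) / h m" for m x
  have d0: "integral\<^sup>L lborel (d m) = 0" for m
    unfolding d_def using intf intfs by (simp add: integral_lborel_shift)
  \<comment> \<open>Shifts have length at most \<open>1\<close>: a nonzero quotient at \<open>x\<close> forces \<open>norm x \<le> r + 1\<close>, and its mean value point lies in the ball of radius \<open>r + 2\<close>.\<close>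
  have "compact (f' ` cball 0 (r + 2))"
    using cont by (auto intro!: compact_continuous_image intro: continuous_on_subset)
  then obtain B where B: "\<And>x. x \<in> cball 0 (r + 2) \<Longrightarrow> norm (f' x) \<le> B"
    using compact_imp_bounded[of "f' ` cball 0 (r + 2)"] unfolding bounded_iff by blast
  have bound: "norm (d m x) \<le> \<bar>B\<bar> * indicator (cball 0 (r + 1)) x" for m x
  proof (cases "norm x \<le> r + 1")
    case True
    have "\<exists>z>0. z < h m \<and> f (x + h m *\<^sub>R axis i 1) - f (x + 0 *\<^sub>R axis i 1)
        = (h m - 0) * f' (x + z *\<^sub>R axis i 1)"
      by (rule MVT2) (use h in \<open>auto intro!: has_partial_along_line f'\<close>)
    then obtain z where z: "0 < z" "z < h m" "d m x = f' (x + z *\<^sub>R e)"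
      using h[of m] by (auto simp: d_def e_def)
    have "norm (x + z *\<^sub>R e) \<le> norm x + norm (z *\<^sub>R e)"
      by (rule norm_triangle_ineq)
    also have "\<dots> \<le> r + 2" using True z h[of m] by simp
    finally have "norm (f' (x + z *\<^sub>R e)) \<le> B" by (intro B) simp
    then show ?thesis using True z by simp
  next
    case False
    have "norm x \<le> norm (x + h m *\<^sub>R e) + norm (h m *\<^sub>R e)"
      using norm_triangle_ineq4[of "x + h m *\<^sub>R e" "h m *\<^sub>R e"] by simp
    then have "r < norm (x + h m *\<^sub>R e)" using False h[of m] by simp
    then show ?thesis using False by (simp add: d_def supp)
  qed
  have lim: "(\<lambda>m. d m x) \<longlonglongrightarrow> f' x" for x
  proof -
    have "((\<lambda>k. (f (x + k *\<^sub>R e) - f x) / k) \<longlongrightarrow> f' x) (at 0)"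
      using f'[of x] by (simp add: has_partial_def has_field_derivative_iff e_def)
    moreover have "filterlim h (at 0) sequentially"
      unfolding filterlim_at using h LIMSEQ_inverse_real_of_nat
      by (auto simp: h_def[abs_def] intro!: always_eventually)
    ultimately show ?thesis
      unfolding d_def by (rule filterlim_compose)
  qed
  have "(\<lambda>m. integral\<^sup>L lborel (d m)) \<longlonglongrightarrow> integral\<^sup>L lborel f'"
  proof (rule integral_dominated_convergence)
    show "integrable lborel (\<lambda>x::real^'n. \<bar>B\<bar> * indicator (cball 0 (r + 1)) x)"
      using emeasure_lborel_cball_finite
      by (intro integrable_mult_right integrable_real_indicator) (auto)
    show "d m \<in> borel_measurable lborel" for m
      unfolding d_def by measurable
  qed (use lim bound in auto)
  then show ?thesis
    by (simp add: d0 LIMSEQ_const_iff)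
qed

section \<open>The cutoff functions\<close>

lemma has_derivative_positive_part_power:
  "((\<lambda>y::real. max 0 y ^ Suc (Suc k)) has_real_derivative real (Suc (Suc k)) * max 0 y ^ Suc k) (at y)"
proof -
  consider "y = 0" | "y > 0" | "y < 0" by linarith
  then show ?thesis
  proof cases
    case 1
    have "((\<lambda>y::real. max 0 y ^ Suc k) \<longlongrightarrow> max 0 0 ^ Suc k) (at 0)"
      by (intro tendsto_intros)
    then have "((\<lambda>y::real. max 0 y ^ Suc k) \<longlongrightarrow> 0) (at 0)" by simp
    then have "((\<lambda>y::real. (max 0 y ^ Suc (Suc k) - 0) / (y - 0)) \<longlongrightarrow> 0) (at 0)"
      by (rule Lim_transform_eventually) (auto simp: eventually_at_filter max_def)
    then show ?thesis
      using 1 by (simp add: has_field_derivative_iff)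
  next
    case 2
    have "((\<lambda>y::real. y ^ Suc (Suc k)) has_real_derivative real (Suc (Suc k)) * y ^ Suc k) (at y)"
      using DERIV_pow[of "Suc (Suc k)" y] by simp
    then have "((\<lambda>y::real. max 0 y ^ Suc (Suc k)) has_real_derivative real (Suc (Suc k)) * y ^ Suc k) (at y)"
      by (rule has_field_derivative_transform_within_open[of _ _ _ "{0<..}"]) (use 2 in auto)
    then show ?thesis using 2 by simp
  next
    case 3
    have "((\<lambda>y::real. 0) has_real_derivative 0) (at y)"
      by simp
    then have "((\<lambda>y::real. max 0 y ^ Suc (Suc k)) has_real_derivative 0) (at y)"
      by (rule has_field_derivative_transform_within_open[of _ _ _ "{..<0}"]) (use 3 in auto)
    then show ?thesis using 3 by simp
  qed
qed

definition cutoff_base :: "real \<Rightarrow> real^'n::finite \<Rightarrow> real" where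
  "cutoff_base \<rho> x = max 0 (1 - \<rho> * (norm x)\<^sup>2)"

text \<open>The cube is the smallest integer power of the positive part that is twice continuously
  differentiable. The parameter \<open>\<rho>\<close> is the inverse square of the radius of the support.\<close>

definition cutoff :: "real \<Rightarrow> real^'n::finite \<Rightarrow> real" where
  "cutoff \<rho> x = cutoff_base \<rho> x ^ 3"

definition cutoff_grad :: "real \<Rightarrow> 'n \<Rightarrow> real^'n::finite \<Rightarrow> real" where
  "cutoff_grad \<rho> j x = cutoff_base \<rho> x ^ 2 * (-6 * \<rho> * x $ j)"

definition cutoff_hess :: "real \<Rightarrow> 'n \<Rightarrow> 'n \<Rightarrow> real^'n::finite \<Rightarrow> real" where
  "cutoff_hess \<rho> i j x =
     24 * \<rho>\<^sup>2 * (x $ i * x $ j) * cutoff_base \<rho> x - (if i = j then 6 * \<rho> else 0) * cutoff_base \<rho> x ^ 2"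

lemma has_partial_cutoff_base_power:
  "has_partial i (\<lambda>y. cutoff_base \<rho> y ^ Suc (Suc k)) x
     (real (Suc (Suc k)) * cutoff_base \<rho> x ^ Suc k * (- 2 * \<rho> * x $ i))"
proof -
  have "has_partial i (\<lambda>y. 1 - \<rho> * (norm y)\<^sup>2) x (0 - (0 * (norm x)\<^sup>2 + \<rho> * (2 * x $ i)))"
    by (intro has_partial_diff has_partial_mult has_partial_const has_partial_norm_square)
  then have "has_partial i (\<lambda>y. 1 - \<rho> * (norm y)\<^sup>2) x (- 2 * \<rho> * x $ i)"
    by (simp add: algebra_simps)
  from has_partial_compose[OF has_derivative_positive_part_power this, of k] show ?thesis
    by (simp only: cutoff_base_def)
qed

lemma has_partial_cutoff: "has_partial j (cutoff \<rho>) x (cutoff_grad \<rho> j x)"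
proof -
  have "has_partial j (\<lambda>y. cutoff_base \<rho> y ^ 3) x (cutoff_base \<rho> x ^ 2 * (-6 * \<rho> * x $ j))"
    using has_partial_cutoff_base_power[of j \<rho> 1 x] by (simp add: numeral_eq_Suc algebra_simps)
  then show ?thesis by (simp only: cutoff_def[abs_def] cutoff_grad_def)
qed

lemma has_partial_cutoff_grad: "has_partial i (cutoff_grad \<rho> j) x (cutoff_hess \<rho> i j x)"
proof -
  have 1: "has_partial i (\<lambda>y. cutoff_base \<rho> y ^ 2) x (2 * cutoff_base \<rho> x * (- 2 * \<rho> * x $ i))"
    using has_partial_cutoff_base_power[of i \<rho> 0 x] by (simp add: numeral_eq_Suc)
  have "has_partial i (\<lambda>y. -6 * \<rho> * y $ j) x (0 * x $ j + -6 * \<rho> * (if i = j then 1 else 0))"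
    by (intro has_partial_mult has_partial_const has_partial_component)
  from has_partial_mult[OF 1 this] have "has_partial i (cutoff_grad \<rho> j) x
     (2 * cutoff_base \<rho> x * (- 2 * \<rho> * x $ i) * (-6 * \<rho> * x $ j) +
      cutoff_base \<rho> x ^ 2 * (0 * x $ j + -6 * \<rho> * (if i = j then 1 else 0)))"
    by (simp only: cutoff_grad_def[abs_def])
  also have "(2 * cutoff_base \<rho> x * (- 2 * \<rho> * x $ i) * (-6 * \<rho> * x $ j) +
      cutoff_base \<rho> x ^ 2 * (0 * x $ j + -6 * \<rho> * (if i = j then 1 else 0))) = cutoff_hess \<rho> i j x"
    by (simp add: cutoff_hess_def power2_eq_square)
  finally show ?thesis .
qed

lemma continuous_cutoff:
  "continuous_on S (cutoff \<rho>)" "continuous_on S (cutoff_grad \<rho> j)" "continuous_on S (cutoff_hess \<rho> i j)"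
  unfolding cutoff_def[abs_def] cutoff_grad_def[abs_def] cutoff_hess_def[abs_def] cutoff_base_def[abs_def]
  by (intro continuous_intros)+

lemma cutoff_base_bounds:
  assumes "0 \<le> \<rho>"
  shows "0 \<le> cutoff_base \<rho> x" "cutoff_base \<rho> x \<le> 1"
  using assms by (auto simp: cutoff_base_def)

lemma cutoff_base_eq_0: "1 \<le> \<rho> * (norm x)\<^sup>2 \<Longrightarrow> cutoff_base \<rho> x = 0"
  by (simp add: cutoff_base_def)

lemma cutoff_support:
  assumes "0 < \<rho>" "1 / sqrt \<rho> < norm x"
  shows "cutoff \<rho> x = 0" "cutoff_grad \<rho> j x = 0" "cutoff_hess \<rho> i j x = 0"
proof -
  have "(1 / sqrt \<rho>)\<^sup>2 \<le> (norm x)\<^sup>2"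
    using assms by (intro power_mono) auto
  then have "1 \<le> \<rho> * (norm x)\<^sup>2"
    using assms(1) by (simp add: power_divide field_simps)
  then show "cutoff \<rho> x = 0" "cutoff_grad \<rho> j x = 0" "cutoff_hess \<rho> i j x = 0"
    by (simp_all add: cutoff_def cutoff_grad_def cutoff_hess_def cutoff_base_eq_0)
qed

lemma cutoff_nonneg: "0 \<le> cutoff \<rho> x"
  by (simp add: cutoff_def cutoff_base_def)

lemma cutoff_antimono: "\<rho>' \<le> \<rho> \<Longrightarrow> cutoff \<rho> x \<le> cutoff \<rho>' x"
  unfolding cutoff_def cutoff_base_def
  by (intro power_mono max.mono diff_left_mono mult_right_mono) auto

lemma tendsto_cutoff:
  "(\<lambda>\<rho>. cutoff \<rho> x) \<midarrow>0\<rightarrow> 1" "(\<lambda>\<rho>. cutoff_grad \<rho> j x) \<midarrow>0\<rightarrow> 0" "(\<lambda>\<rho>. cutoff_hess \<rho> i j x) \<midarrow>0\<rightarrow> 0"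
proof -
  have "(\<lambda>\<rho>. cutoff_base \<rho> x) \<midarrow>0\<rightarrow> max 0 (1 - 0 * (norm x)\<^sup>2)"
    unfolding cutoff_base_def by (intro tendsto_intros)
  then have *: "(\<lambda>\<rho>. cutoff_base \<rho> x) \<midarrow>0\<rightarrow> 1" by simp
  have "(\<lambda>\<rho>. cutoff \<rho> x) \<midarrow>0\<rightarrow> 1 ^ 3"
    unfolding cutoff_def by (intro tendsto_intros *)
  then show "(\<lambda>\<rho>. cutoff \<rho> x) \<midarrow>0\<rightarrow> 1" by simp
  have "(\<lambda>\<rho>. cutoff_grad \<rho> j x) \<midarrow>0\<rightarrow> 1 ^ 2 * (-6 * 0 * x $ j)"
    unfolding cutoff_grad_def by (intro tendsto_intros *)
  then show "(\<lambda>\<rho>. cutoff_grad \<rho> j x) \<midarrow>0\<rightarrow> 0" by simp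
  have "(\<lambda>\<rho>. cutoff_hess \<rho> i j x) \<midarrow>0\<rightarrow> 24 * 0\<^sup>2 * (x $ i * x $ j) * 1 - (if i = j then 6 * 0 else 0) * 1 ^ 2"
    unfolding cutoff_hess_def by (cases "i = j") (auto intro!: tendsto_eq_intros *)
  then show "(\<lambda>\<rho>. cutoff_hess \<rho> i j x) \<midarrow>0\<rightarrow> 0" by (simp split: if_splits)
qed

text \<open>On the support \<open>\<rho> |x|\<^sup>2 \<le> 1\<close>, while the gradient is of size \<open>6 \<rho> |x|\<close>; the product with \<open>1 + |x|\<close> is
  therefore bounded independently of \<open>\<rho>\<close>.\<close>

lemma cutoff_grad_weighted_bound:
  assumes "0 \<le> \<rho>" "\<rho> \<le> 1"
  shows "(1 + norm x) * \<bar>cutoff_grad \<rho> j x\<bar> \<le> 18"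
proof (cases "\<rho> * (norm x)\<^sup>2 \<le> 1")
  case True
  have "2 * norm x \<le> (norm x)\<^sup>2 + 1"
    using zero_le_power2[of "norm x - 1"] by (simp add: power2_diff)
  then have "norm x \<le> 1 + (norm x)\<^sup>2"
    using norm_ge_zero[of x] by linarith
  have "\<bar>cutoff_grad \<rho> j x\<bar> = cutoff_base \<rho> x ^ 2 * (6 * \<rho> * \<bar>x $ j\<bar>)"
    using assms by (simp add: cutoff_grad_def abs_mult)
  also have "\<dots> \<le> 1 * (6 * \<rho> * norm x)"
    using cutoff_base_bounds[OF assms(1), of x] assms component_le_norm_cart[of x j]
    by (intro mult_mono power_le_one) auto
  finally have "(1 + norm x) * \<bar>cutoff_grad \<rho> j x\<bar> \<le> (1 + norm x) * (6 * \<rho> * norm x)"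
    by (intro mult_left_mono) auto
  also have "\<dots> = 6 * \<rho> * (norm x + (norm x)\<^sup>2)"
    by (simp add: power2_eq_square algebra_simps)
  also have "\<dots> \<le> 6 * \<rho> * (1 + (norm x)\<^sup>2 + (norm x)\<^sup>2)"
    using assms \<open>norm x \<le> 1 + (norm x)\<^sup>2\<close> by (intro mult_left_mono) auto
  also have "\<dots> = 6 * \<rho> + 12 * (\<rho> * (norm x)\<^sup>2)"
    by (simp add: algebra_simps)
  also have "\<dots> \<le> 18" using True assms by simp
  finally show ?thesis .
qed (simp add: cutoff_grad_def cutoff_base_eq_0)

text \<open>On the support the Hessian is of size \<open>\<rho>\<close>, which compensates the growth \<open>1 + |x|\<^sup>2 \<le> 1 + 1 / \<rho>\<close>.\<close>

lemma cutoff_hess_weighted_bound: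
  assumes "0 \<le> \<rho>" "\<rho> \<le> 1"
  shows "(1 + (norm x)\<^sup>2) * \<bar>cutoff_hess \<rho> i j x\<bar> \<le> 60"
proof (cases "\<rho> * (norm x)\<^sup>2 \<le> 1")
  case True
  note b = cutoff_base_bounds[OF assms(1), of x]
  have "\<bar>cutoff_hess \<rho> i j x\<bar> \<le> 24 * \<rho>\<^sup>2 * (\<bar>x $ i\<bar> * \<bar>x $ j\<bar>) * cutoff_base \<rho> x + 6 * \<rho> * cutoff_base \<rho> x ^ 2"
    unfolding cutoff_hess_def using b assms by (intro order_trans[OF abs_triangle_ineq4] add_mono) (auto simp: abs_mult)
  also have "\<dots> \<le> 24 * \<rho>\<^sup>2 * (norm x * norm x) * 1 + 6 * \<rho> * 1"
    using b assms component_le_norm_cart[of x j] component_le_norm_cart[of x i]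
    by (intro mult_mono power_le_one add_mono) auto
  also have "\<dots> = \<rho> * (24 * (\<rho> * (norm x)\<^sup>2) + 6)"
    by (simp add: power2_eq_square algebra_simps)
  also have "\<dots> \<le> \<rho> * 30"
    using True assms by (intro mult_left_mono) auto
  finally have "(1 + (norm x)\<^sup>2) * \<bar>cutoff_hess \<rho> i j x\<bar> \<le> (1 + (norm x)\<^sup>2) * (\<rho> * 30)"
    by (intro mult_left_mono) auto
  also have "\<dots> = 30 * \<rho> + 30 * (\<rho> * (norm x)\<^sup>2)"
    by (simp add: algebra_simps)
  also have "\<dots> \<le> 60" using True assms by simp
  finally show ?thesis .
qed (simp add: cutoff_hess_def cutoff_base_eq_0)

lemma filterlim_inverse_Suc_at_0: "filterlim (\<lambda>m. 1 / real (Suc m)) (at 0) sequentially"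
  unfolding filterlim_at using LIMSEQ_inverse_real_of_nat
  by (auto simp: inverse_eq_divide intro!: always_eventually)

text \<open>Monotone convergence along \<open>\<rho> = 1 / (m + 1)\<close>. The map \<open>\<pi>\<close> allows the cutoff to act on the space
  component of points of a product. The sign of \<open>f\<close> is arbitrary because \<open>ennreal\<close> truncates and
  the cutoff is nonnegative.\<close>

lemma tendsto_nn_integral_cutoff:
  fixes f :: "'a::euclidean_space \<Rightarrow> real" and \<pi> :: "'a \<Rightarrow> real^'n::finite"
  assumes [measurable]: "f \<in> borel_measurable borel" and \<pi>: "continuous_on UNIV \<pi>"
  shows "(\<lambda>m. \<integral>\<^sup>+z. ennreal (cutoff (1 / real (Suc m)) (\<pi> z) * f z) \<partial>lborel)
    \<longlonglongrightarrow> (\<integral>\<^sup>+z. ennreal (f z) \<partial>lborel)"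
proof (rule nn_integral_LIMSEQ)
  have [measurable]: "(\<lambda>z. cutoff \<rho> (\<pi> z)) \<in> borel_measurable borel" for \<rho>
    by (intro borel_measurable_continuous_onI continuous_on_compose2[OF continuous_cutoff(1)[of UNIV] \<pi>]) auto
  show "(\<lambda>z. ennreal (cutoff (1 / real (Suc m)) (\<pi> z) * f z)) \<in> borel_measurable lborel" for m
    by measurable
  show "incseq (\<lambda>m z. ennreal (cutoff (1 / real (Suc m)) (\<pi> z) * f z))"
  proof (intro incseq_SucI le_funI)
    fix m z
    have "cutoff (1 / real (Suc m)) (\<pi> z) \<le> cutoff (1 / real (Suc (Suc m))) (\<pi> z)"
      by (intro cutoff_antimono) (simp add: field_simps)
    then show "ennreal (cutoff (1 / real (Suc m)) (\<pi> z) * f z)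
        \<le> ennreal (cutoff (1 / real (Suc (Suc m))) (\<pi> z) * f z)"
      by (simp only: ennreal_mult'[OF cutoff_nonneg] mult_right_mono ennreal_leI zero_le)
  qed
  fix z
  have "(\<lambda>m. cutoff (1 / real (Suc m)) (\<pi> z)) \<longlonglongrightarrow> 1"
    by (rule filterlim_compose[OF tendsto_cutoff(1) filterlim_inverse_Suc_at_0])
  then have "(\<lambda>m. cutoff (1 / real (Suc m)) (\<pi> z) * f z) \<longlonglongrightarrow> 1 * f z"
    by (intro tendsto_intros)
  then show "(\<lambda>m. ennreal (cutoff (1 / real (Suc m)) (\<pi> z) * f z)) \<longlonglongrightarrow> ennreal (f z)"
    by (intro tendsto_ennrealI) simp
qed

section \<open>Growth at infinity as a global bound\<close>

lemma growth_O_bound: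
  fixes f :: "real^'n::finite \<Rightarrow> real \<Rightarrow> 'b::real_normed_vector"
  assumes "growth_O I k f" "compact K" "K \<subseteq> I"
    and cont: "continuous_on (UNIV \<times> K) (\<lambda>z. f (fst z) (snd z))"
  obtains C where "0 \<le> C" "\<And>x t. t \<in> K \<Longrightarrow> norm (f x t) \<le> C * (1 + norm x ^ k)"
proof -
  have "(\<lambda>(x, t). norm (f x t)) \<in> O[at_infinity \<times>\<^sub>F principal K](\<lambda>(x, t). norm x ^ k)"
    using assms(1-3) by (auto simp: growth_O_def)
  then obtain c where c: "c > 0"
    "eventually (\<lambda>(x, t). norm (f x t) \<le> c * norm x ^ k) (at_infinity \<times>\<^sub>F principal K)"
    by (auto elim!: landau_o.bigE simp: case_prod_beta')
  then obtain P Q where P: "eventually P at_infinity" and Q: "eventually Q (principal K)"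
    and PQ: "\<And>x t. P x \<Longrightarrow> Q t \<Longrightarrow> norm (f x t) \<le> c * norm x ^ k"
    unfolding eventually_prod_filter by auto
  obtain M where M: "\<And>x. M \<le> norm x \<Longrightarrow> P x"
    using P unfolding eventually_at_infinity by auto
  have Q: "Q t" if "t \<in> K" for t
    using Q that by (auto simp: eventually_principal)
  have "compact ((\<lambda>z. f (fst z) (snd z)) ` (cball 0 M \<times> K))"
    using assms(2) cont by (intro compact_continuous_image compact_Times) (auto intro: continuous_on_subset)
  then obtain B where B: "\<And>z. z \<in> cball 0 M \<times> K \<Longrightarrow> norm (f (fst z) (snd z)) \<le> B"
    using compact_imp_bounded[of "(\<lambda>z. f (fst z) (snd z)) ` (cball 0 M \<times> K)"]
    unfolding bounded_iff by blast
  show thesis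
  proof
    show "0 \<le> c + \<bar>B\<bar>" using c by simp
    fix x :: "real^'n" and t assume t: "t \<in> K"
    have "norm (f x t) \<le> (if M \<le> norm x then c * norm x ^ k else \<bar>B\<bar>)"
      using PQ[OF M[of x] Q[OF t]] B[of "(x, t)"] t by (auto simp: mem_cball)
    also have "\<dots> \<le> c * norm x ^ k + \<bar>B\<bar>" using c by simp
    also have "\<dots> \<le> (c + \<bar>B\<bar>) * (1 + norm x ^ k)"
      using c by (simp add: algebra_simps)
    finally show "norm (f x t) \<le> (c + \<bar>B\<bar>) * (1 + norm x ^ k)" .
  qed
qed

section \<open>Integration over strips in space-time\<close>

lemma integrable_strip_compact_support:
  fixes g :: "'a::euclidean_space \<Rightarrow> real \<Rightarrow> real"
  assumes g: "continuous_on (UNIV \<times> {s..t}) (\<lambda>z. g (fst z) (snd z))"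
    and supp: "\<And>x \<tau>. r < norm x \<Longrightarrow> g x \<tau> = 0"
  shows "integrable lborel (\<lambda>z. indicator {s..t} (snd z) * g (fst z) (snd z))"
proof -
  have "integrable lborel (\<lambda>z. indicator (cball 0 r \<times> {s..t}) z *\<^sub>R g (fst z) (snd z))"
    by (rule borel_integrable_compact) (auto intro: compact_Times continuous_on_subset[OF g])
  also have "(\<lambda>z. indicator (cball 0 r \<times> {s..t}) z *\<^sub>R g (fst z) (snd z))
      = (\<lambda>z. indicator {s..t} (snd z) * g (fst z) (snd z))"
    using supp by (fastforce simp: indicator_def fun_eq_iff)
  finally show ?thesis .
qed

lemma measurable_strip:
  fixes g :: "'a::euclidean_space \<Rightarrow> real \<Rightarrow> real"
  assumes "continuous_on (UNIV \<times> {s..t}) (\<lambda>z. g (fst z) (snd z))"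
  shows "(\<lambda>z. indicator {s..t} (snd z) * g (fst z) (snd z)) \<in> borel_measurable borel"
proof -
  have "closed ((UNIV::'a set) \<times> {s..t})"
    by (intro closed_Times) auto
  then have "(\<lambda>z. indicator (UNIV \<times> {s..t}) z *\<^sub>R g (fst z) (snd z)) \<in> borel_measurable borel"
    using assms by (intro borel_measurable_continuous_on_indicator) auto
  also have "(\<lambda>z. indicator (UNIV \<times> {s..t}) z *\<^sub>R g (fst z) (snd z))
      = (\<lambda>z. indicator {s..t} (snd z) * g (fst z) (snd z))"
    by (auto simp: indicator_def fun_eq_iff)
  finally show ?thesis .
qed

lemma nn_integral_strip:
  fixes g :: "'a::euclidean_space \<Rightarrow> real \<Rightarrow> real"
  assumes "continuous_on (UNIV \<times> {s..t}) (\<lambda>z. g (fst z) (snd z))"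
  shows "(\<integral>\<^sup>+\<tau>\<in>{s..t}. (\<integral>\<^sup>+x. ennreal (g x \<tau>) \<partial>lborel) \<partial>lborel)
    = (\<integral>\<^sup>+z. ennreal (indicator {s..t} (snd z) * g (fst z) (snd z)) \<partial>lborel)"
proof -
  let ?f = "\<lambda>z. ennreal (indicator {s..t} (snd z) * g (fst z) (snd z))"
  have "?f \<in> borel_measurable (lborel \<Otimes>\<^sub>M lborel)"
    using measurable_strip[OF assms] by (simp add: lborel_prod)
  then have "(\<integral>\<^sup>+z. ?f z \<partial>lborel) = (\<integral>\<^sup>+\<tau>. (\<integral>\<^sup>+x. ?f (x, \<tau>) \<partial>lborel) \<partial>lborel)"
    using lborel_pair.nn_integral_snd[of ?f] by (simp only: lborel_prod)
  also have "\<dots> = (\<integral>\<^sup>+\<tau>\<in>{s..t}. (\<integral>\<^sup>+x. ennreal (g x \<tau>) \<partial>lborel) \<partial>lborel)"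
    by (intro nn_integral_cong) (auto simp: indicator_def)
  finally show ?thesis ..
qed

lemma integral_strip:
  fixes g :: "'a::euclidean_space \<Rightarrow> real \<Rightarrow> real"
  assumes "integrable lborel (\<lambda>z. indicator {s..t} (snd z) * g (fst z) (snd z))"
  shows "set_integrable lborel (UNIV \<times> {s..t}) (\<lambda>(x, \<tau>). g x \<tau>)"
    and "(LBINT \<tau>:{s..t}. (LBINT x. g x \<tau>)) = (\<integral>z. indicator {s..t} (snd z) * g (fst z) (snd z) \<partial>lborel)"
proof -
  have "(\<lambda>z::'a \<times> real. indicator (UNIV \<times> {s..t}) z *\<^sub>R (case z of (x, \<tau>) \<Rightarrow> g x \<tau>))
      = (\<lambda>z. indicator {s..t} (snd z) * g (fst z) (snd z))"
    by (auto simp: indicator_def fun_eq_iff)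
  then show "set_integrable lborel (UNIV \<times> {s..t}) (\<lambda>(x, \<tau>). g x \<tau>)"
    using assms by (simp add: set_integrable_def)
  have "(\<integral>z. indicator {s..t} (snd z) * g (fst z) (snd z) \<partial>lborel)
      = (\<integral>z. (\<lambda>(x, \<tau>). indicator {s..t} \<tau> * g x \<tau>) z \<partial>(lborel \<Otimes>\<^sub>M lborel))"
    by (simp add: lborel_prod case_prod_beta')
  also have "\<dots> = (\<integral>\<tau>. (\<integral>x. indicator {s..t} \<tau> * g x \<tau> \<partial>lborel) \<partial>lborel)"
    using assms by (intro lborel_pair.integral_snd[symmetric]) (simp add: lborel_prod case_prod_beta')
  finally show "(LBINT \<tau>:{s..t}. (LBINT x. g x \<tau>)) = (\<integral>z. indicator {s..t} (snd z) * g (fst z) (snd z) \<partial>lborel)"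
    by (simp add: set_lebesgue_integral_def)
qed

section \<open>Balance laws\<close>

text \<open>Integrating \<open>\<partial>\<^sub>t w = div F + H\<close> over the strip, in time first, gives the difference of the
  integrals of \<open>w\<close>; integrating \<open>div F\<close> in space first gives zero. Compact support in space makes
  Fubini's theorem applicable in both orders.\<close>

lemma balance_law_compact_support:
  fixes w w' H :: "real^'n::finite \<Rightarrow> real \<Rightarrow> real" and F F' :: "'n \<Rightarrow> real^'n \<Rightarrow> real \<Rightarrow> real"
  assumes "s \<le> t"
    and w': "\<And>x \<tau>. \<tau> \<in> {s..t} \<Longrightarrow> ((\<lambda>\<tau>. w x \<tau>) has_vector_derivative w' x \<tau>) (at \<tau> within {s..t})"
    and F': "\<And>i x \<tau>. \<tau> \<in> {s..t} \<Longrightarrow> has_partial i (\<lambda>y. F i y \<tau>) x (F' i x \<tau>)"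
    and balance: "\<And>x \<tau>. \<tau> \<in> {s..t} \<Longrightarrow> w' x \<tau> = (\<Sum>i\<in>UNIV. F' i x \<tau>) + H x \<tau>"
    and cw: "\<And>\<tau>. \<tau> \<in> {s..t} \<Longrightarrow> continuous_on UNIV (\<lambda>x. w x \<tau>)"
    and cF: "\<And>i \<tau>. \<tau> \<in> {s..t} \<Longrightarrow> continuous_on UNIV (\<lambda>x. F i x \<tau>)"
    and cF': "\<And>i. continuous_on (UNIV \<times> {s..t}) (\<lambda>z. F' i (fst z) (snd z))"
    and cH: "continuous_on (UNIV \<times> {s..t}) (\<lambda>z. H (fst z) (snd z))"
    and supp: "\<And>x \<tau>. r < norm x \<Longrightarrow> w x \<tau> = 0" "\<And>i x \<tau>. r < norm x \<Longrightarrow> F i x \<tau> = 0"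
      "\<And>i x \<tau>. r < norm x \<Longrightarrow> F' i x \<tau> = 0" "\<And>x \<tau>. r < norm x \<Longrightarrow> H x \<tau> = 0"
  shows "(\<integral>x. w x t \<partial>lborel) = (\<integral>x. w x s \<partial>lborel) + (\<integral>z. indicator {s..t} (snd z) * H (fst z) (snd z) \<partial>lborel)"
proof -
  let ?K = "{s..t}" and ?D = "\<lambda>x \<tau>. \<Sum>i\<in>UNIV. F' i x \<tau>"
  have cD: "continuous_on (UNIV \<times> ?K) (\<lambda>z. ?D (fst z) (snd z))"
    by (intro continuous_intros cF')
  note intH = integrable_strip_compact_support[OF cH supp(4)]
  have intD: "integrable lborel (\<lambda>z. indicator ?K (snd z) * ?D (fst z) (snd z))"
    by (rule integrable_strip_compact_support[where r = r, OF cD]) (simp add: supp)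
  have D0: "(\<integral>z. indicator ?K (snd z) * ?D (fst z) (snd z) \<partial>lborel) = 0"
  proof -
    have "(\<integral>z. indicator ?K (snd z) * ?D (fst z) (snd z) \<partial>lborel)
       = (\<integral>\<tau>. indicator ?K \<tau> * (\<integral>x. ?D x \<tau> \<partial>lborel) \<partial>lborel)"
      using integral_strip(2)[OF intD] by (simp add: set_lebesgue_integral_def)
    also have "\<dots> = (\<integral>\<tau>. 0 \<partial>(lborel::real measure))"
    proof (rule Bochner_Integration.integral_cong[OF refl])
      fix \<tau> :: real
      show "indicator ?K \<tau> * (\<integral>x. ?D x \<tau> \<partial>lborel) = 0"
      proof (cases "\<tau> \<in> ?K")
        case True
        have c: "continuous_on UNIV (\<lambda>x. F' i x \<tau>)" for i
          using True by (auto intro!: continuous_on_compose2[OF cF', of _ "\<lambda>x. (x, \<tau>)", simplified] continuous_intros)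
        have "(\<integral>x. ?D x \<tau> \<partial>lborel) = (\<Sum>i\<in>UNIV. \<integral>x. F' i x \<tau> \<partial>lborel)"
          using c supp(3)
          by (intro Bochner_Integration.integral_sum integrable_compact_support[of "cball 0 r"])
             (auto intro: continuous_on_subset)
        also have "\<dots> = 0"
          using integral_partial_eq_zero[OF F'[OF True] cF[OF True] c supp(2)] by simp
        finally show ?thesis using True by simp
      qed simp
    qed
    finally show ?thesis by simp
  qed
  have "(\<integral>z. indicator ?K (snd z) * H (fst z) (snd z) \<partial>lborel)
     = (\<integral>z. indicator ?K (snd z) * ?D (fst z) (snd z) + indicator ?K (snd z) * H (fst z) (snd z) \<partial>lborel)"
    using intD intH D0 by simp
  also have "\<dots> = (\<integral>z. (\<lambda>(x, \<tau>). indicator ?K \<tau> * w' x \<tau>) z \<partial>(lborel \<Otimes>\<^sub>M lborel))"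
    unfolding lborel_prod
    by (rule Bochner_Integration.integral_cong) (auto simp: indicator_def balance)
  also have "\<dots> = (\<integral>x. (\<integral>\<tau>. indicator ?K \<tau> * w' x \<tau> \<partial>lborel) \<partial>lborel)"
  proof (rule lborel_pair.integral_fst[symmetric])
    have "integrable lborel (\<lambda>z. indicator ?K (snd z) * ?D (fst z) (snd z) + indicator ?K (snd z) * H (fst z) (snd z))"
      using intD intH by simp
    also have "(\<lambda>z. indicator ?K (snd z) * ?D (fst z) (snd z) + indicator ?K (snd z) * H (fst z) (snd z))
      = (\<lambda>(x, \<tau>). indicator ?K \<tau> * w' x \<tau>)"
      by (auto simp: indicator_def balance fun_eq_iff)
    finally show "integrable (lborel \<Otimes>\<^sub>M lborel) (\<lambda>(x, \<tau>). indicator ?K \<tau> * w' x \<tau>)"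
      by (simp add: lborel_prod)
  qed
  also have "\<dots> = (\<integral>x. w x t - w x s \<partial>lborel)"
  proof (rule Bochner_Integration.integral_cong[OF refl])
    fix x :: "real^'n"
    have "continuous_on ?K (\<lambda>\<tau>. ?D x \<tau> + H x \<tau>)"
      by (intro continuous_on_add continuous_on_compose2[OF cD, of _ "\<lambda>\<tau>. (x, \<tau>)", simplified]
           continuous_on_compose2[OF cH, of _ "\<lambda>\<tau>. (x, \<tau>)", simplified] continuous_intros) auto
    then have "continuous_on ?K (\<lambda>\<tau>. w' x \<tau>)"
      by (rule continuous_on_eq) (simp add: balance)
    then show "(\<integral>\<tau>. indicator ?K \<tau> * w' x \<tau> \<partial>lborel) = w x t - w x s"
      using integral_FTC_atLeastAtMost[OF \<open>s \<le> t\<close>, of "w x" "w' x"] w' by simp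
  qed
  also have "\<dots> = (\<integral>x. w x t \<partial>lborel) - (\<integral>x. w x s \<partial>lborel)"
    using supp(1) cw assms(1)
    by (intro Bochner_Integration.integral_diff integrable_compact_support[of "cball 0 r"])
       (auto intro: continuous_on_subset)
  finally show ?thesis by simp
qed

text \<open>The pointwise form of the energy balance, in which \<open>v\<close>, \<open>vt\<close>, \<open>u1\<close>, \<open>u2\<close> are the values of the
  solution and its derivatives, \<open>g = |v|\<^sup>q\<^sup>-\<^sup>2 v\<close>, \<open>p = |v|\<^sup>q\<^sup>-\<^sup>2\<close>, \<open>U = |v|\<^sup>q\<close>, and \<open>\<eta>1\<close>, \<open>\<eta>2\<close> are the
  derivatives of the cutoff. The sum over \<open>i\<close> on the right is the divergence of the flux written out
  by the product rule. The terms \<open>\<nabla>\<eta> \<bullet> a \<nabla>u\<close> and \<open>\<nabla>u \<bullet> a \<nabla>\<eta>\<close> in it cancel by symmetry of \<open>a\<close>.\<close>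

lemma energy_balance_algebra:
  fixes a a1 u2 \<eta>2 :: "'n::finite \<Rightarrow> 'n \<Rightarrow> real" and u1 \<eta>1 b b1 :: "'n \<Rightarrow> real"
  assumes sym: "\<And>i j. a i j = a j i"
    and gu: "g * v = U"
    and pde: "vt - (\<Sum>i\<in>UNIV. \<Sum>j\<in>UNIV. a1 i j * u1 j + a i j * u2 i j) + (\<Sum>i\<in>UNIV. b i * u1 i) + c * v = 0"
  shows "\<eta> * (q * g * vt) =
    (\<Sum>i\<in>UNIV. (q * \<eta>1 i * g + q * \<eta> * ((q - 1) * p * u1 i)) * (\<Sum>j\<in>UNIV. a i j * u1 j)
        + q * \<eta> * g * (\<Sum>j\<in>UNIV. a1 i j * u1 j + a i j * u2 i j)
      - (q * g * u1 i * (\<Sum>j\<in>UNIV. a i j * \<eta>1 j) + U * (\<Sum>j\<in>UNIV. a1 i j * \<eta>1 j + a i j * \<eta>2 i j))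
      - ((\<eta>1 i * U + \<eta> * (q * g * u1 i)) * b i + \<eta> * U * b1 i))
    + (U * ((\<Sum>i\<in>UNIV. \<Sum>j\<in>UNIV. a1 i j * \<eta>1 j + a i j * \<eta>2 i j) + (\<Sum>i\<in>UNIV. b i * \<eta>1 i))
       - \<eta> * (q * (q - 1) * (p * (\<Sum>i\<in>UNIV. \<Sum>j\<in>UNIV. a i j * u1 i * u1 j))
              + (- (\<Sum>i\<in>UNIV. b1 i) + q * c) * U))"
proof -
  define S M A N where "S i = (\<Sum>j\<in>UNIV. a1 i j * u1 j + a i j * u2 i j)"
    and "M i = (\<Sum>j\<in>UNIV. a1 i j * \<eta>1 j + a i j * \<eta>2 i j)"
    and "A i = (\<Sum>j\<in>UNIV. a i j * u1 j)" and "N i = (\<Sum>j\<in>UNIV. a i j * \<eta>1 j)" for i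
  have "(\<Sum>i\<in>UNIV. \<eta>1 i * A i) = (\<Sum>i\<in>UNIV. \<Sum>j\<in>UNIV. \<eta>1 i * (a i j * u1 j))"
    by (simp add: A_def sum_distrib_left)
  also have "\<dots> = (\<Sum>j\<in>UNIV. \<Sum>i\<in>UNIV. \<eta>1 i * (a i j * u1 j))"
    by (rule sum.swap)
  also have "\<dots> = (\<Sum>i\<in>UNIV. u1 i * N i)"
    unfolding N_def sum_distrib_left
    by (intro sum.cong refl) (subst sym, simp add: ac_simps)
  finally have cross: "(\<Sum>i\<in>UNIV. \<eta>1 i * A i) = (\<Sum>i\<in>UNIV. u1 i * N i)" .
  have quad: "(\<Sum>i\<in>UNIV. \<Sum>j\<in>UNIV. a i j * u1 i * u1 j) = (\<Sum>i\<in>UNIV. u1 i * A i)"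
    by (simp add: A_def sum_distrib_left ac_simps)
  have div: "(\<Sum>i\<in>UNIV. (q * \<eta>1 i * g + q * \<eta> * ((q - 1) * p * u1 i)) * A i + q * \<eta> * g * S i
      - (q * g * u1 i * N i + U * M i)
      - ((\<eta>1 i * U + \<eta> * (q * g * u1 i)) * b i + \<eta> * U * b1 i))
    = q * g * (\<Sum>i\<in>UNIV. \<eta>1 i * A i) + q * (q - 1) * p * \<eta> * (\<Sum>i\<in>UNIV. u1 i * A i)
      + q * \<eta> * g * (\<Sum>i\<in>UNIV. S i) - q * g * (\<Sum>i\<in>UNIV. u1 i * N i) - U * (\<Sum>i\<in>UNIV. M i)
      - U * (\<Sum>i\<in>UNIV. b i * \<eta>1 i) - q * \<eta> * g * (\<Sum>i\<in>UNIV. b i * u1 i) - \<eta> * U * (\<Sum>i\<in>UNIV. b1 i)"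
    unfolding sum_distrib_left sum.distrib[symmetric] sum_subtractf[symmetric]
    by (intro sum.cong refl) (simp add: algebra_simps)
  have vt: "vt = (\<Sum>i\<in>UNIV. S i) - (\<Sum>i\<in>UNIV. b i * u1 i) - c * v"
    using pde by (simp add: S_def)
  show ?thesis
    unfolding S_def[symmetric] M_def[symmetric] A_def[symmetric] N_def[symmetric] quad div cross
    unfolding vt gu[symmetric] by (simp add: algebra_simps)
qed

lemma nn_integral_parts:
  fixes f :: "'a \<Rightarrow> real"
  assumes "integrable M f"
  obtains p n where "0 \<le> p" "0 \<le> n" "(\<integral>\<^sup>+z. ennreal (f z) \<partial>M) = ennreal p"
    "(\<integral>\<^sup>+z. ennreal (- f z) \<partial>M) = ennreal n" "integral\<^sup>L M f = p - n"
proof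
  note fin = real_integrable_def[THEN iffD1, OF assms]
  show "(\<integral>\<^sup>+z. ennreal (f z) \<partial>M) = ennreal (enn2real (\<integral>\<^sup>+z. ennreal (f z) \<partial>M))"
    "(\<integral>\<^sup>+z. ennreal (- f z) \<partial>M) = ennreal (enn2real (\<integral>\<^sup>+z. ennreal (- f z) \<partial>M))"
    using fin by (simp_all add: less_top)
  show "integral\<^sup>L M f = enn2real (\<integral>\<^sup>+z. ennreal (f z) \<partial>M) - enn2real (\<integral>\<^sup>+z. ennreal (- f z) \<partial>M)"
    by (rule real_lebesgue_integral_def[OF assms])
qed simp_all

text \<open>Converts between the balance of real integrals and its form in \<open>[0,\<infinity>]\<close>, in which the negative
  parts of \<open>L\<close> and \<open>E\<close> change sides. The former is what localization yields, the latter is stable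
  under limits that may be infinite.\<close>

lemma signed_balance_iff:
  fixes A B :: "'a \<Rightarrow> real" and G L E :: "'b \<Rightarrow> real"
  assumes "integrable M A" "integrable M B" "integrable M' G" "integrable M' L" "integrable M' E"
    and nonneg: "\<And>x. 0 \<le> A x" "\<And>x. 0 \<le> B x" "\<And>z. 0 \<le> G z"
  shows "(\<integral>\<^sup>+x. A x \<partial>M) + (\<integral>\<^sup>+z. G z \<partial>M') + (\<integral>\<^sup>+z. L z \<partial>M') + (\<integral>\<^sup>+z. ennreal (- E z) \<partial>M')
       = (\<integral>\<^sup>+x. B x \<partial>M) + (\<integral>\<^sup>+z. ennreal (- L z) \<partial>M') + (\<integral>\<^sup>+z. E z \<partial>M')
     \<longleftrightarrow> integral\<^sup>L M A + integral\<^sup>L M' G + integral\<^sup>L M' L = integral\<^sup>L M B + integral\<^sup>L M' E"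
proof -
  obtain lp ln where l: "0 \<le> lp" "0 \<le> ln" "(\<integral>\<^sup>+z. L z \<partial>M') = ennreal lp"
    "(\<integral>\<^sup>+z. ennreal (- L z) \<partial>M') = ennreal ln" "integral\<^sup>L M' L = lp - ln"
    using nn_integral_parts[OF assms(4)] by blast
  obtain ep en where e: "0 \<le> ep" "0 \<le> en" "(\<integral>\<^sup>+z. E z \<partial>M') = ennreal ep"
    "(\<integral>\<^sup>+z. ennreal (- E z) \<partial>M') = ennreal en" "integral\<^sup>L M' E = ep - en"
    using nn_integral_parts[OF assms(5)] by blast
  have n: "0 \<le> integral\<^sup>L M A" "0 \<le> integral\<^sup>L M B" "0 \<le> integral\<^sup>L M' G"
    using nonneg by (auto intro!: integral_nonneg_AE)
  have "(\<integral>\<^sup>+x. A x \<partial>M) = integral\<^sup>L M A" "(\<integral>\<^sup>+x. B x \<partial>M) = integral\<^sup>L M B" "(\<integral>\<^sup>+z. G z \<partial>M') = integral\<^sup>L M' G"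
    using assms by (auto intro!: nn_integral_eq_integral)
  then show ?thesis
    using l e n by (simp add: ennreal_plus[symmetric] del: ennreal_plus) (auto simp: algebra_simps)
qed

section \<open>Solutions of the parabolic equation on a strip\<close>

text \<open>The data of the problem on the compact time interval \<open>[s, t]\<close>. The function \<open>u'\<close> is the time
  derivative of \<open>u\<close>, one-sided at the end points. The divergence in the equation is expanded by the
  product rule, and the growth conditions hold on all of space with a common constant \<open>C\<close>.\<close>

locale parabolic_solution =
  fixes a :: "real^'n::finite \<Rightarrow> real \<Rightarrow> real^'n^'n" and b :: "real^'n \<Rightarrow> real \<Rightarrow> real^'n"
    and c u u' :: "real^'n \<Rightarrow> real \<Rightarrow> real" and q s t C :: real
  assumes s_le_t: "s \<le> t" and q_ge_2: "2 \<le> q"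
    and sym: "\<And>i j x \<tau>. \<tau> \<in> {s..t} \<Longrightarrow> a x \<tau> $ i $ j = a x \<tau> $ j $ i"
    and elliptic: "\<And>\<xi> x \<tau>. \<tau> \<in> {s..t} \<Longrightarrow> 0 \<le> (\<Sum>i\<in>UNIV. \<Sum>j\<in>UNIV. a x \<tau> $ i $ j * \<xi> i * \<xi> j)"
    and cont_a: "\<And>i j. continuous_on (UNIV \<times> {s..t}) (\<lambda>z. a (fst z) (snd z) $ i $ j)"
    and cont_da: "\<And>i j. continuous_on (UNIV \<times> {s..t}) (\<lambda>z. pdx i (\<lambda>x t. a x t $ i $ j) (fst z) (snd z))"
    and partial_a: "\<And>i j x \<tau>. \<tau> \<in> {s..t} \<Longrightarrow>
      has_partial i (\<lambda>y. a y \<tau> $ i $ j) x (pdx i (\<lambda>x t. a x t $ i $ j) x \<tau>)"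
    and cont_b: "\<And>i. continuous_on (UNIV \<times> {s..t}) (\<lambda>z. b (fst z) (snd z) $ i)"
    and cont_db: "\<And>i. continuous_on (UNIV \<times> {s..t}) (\<lambda>z. pdx i (\<lambda>x t. b x t $ i) (fst z) (snd z))"
    and partial_b: "\<And>i x \<tau>. \<tau> \<in> {s..t} \<Longrightarrow>
      has_partial i (\<lambda>y. b y \<tau> $ i) x (pdx i (\<lambda>x t. b x t $ i) x \<tau>)"
    and cont_u: "continuous_on (UNIV \<times> {s..t}) (\<lambda>z. u (fst z) (snd z))"
    and cont_du: "\<And>i. continuous_on (UNIV \<times> {s..t}) (\<lambda>z. pdx i u (fst z) (snd z))"
    and cont_ddu: "\<And>i j. continuous_on (UNIV \<times> {s..t}) (\<lambda>z. pdx i (pdx j u) (fst z) (snd z))"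
    and cont_u': "continuous_on (UNIV \<times> {s..t}) (\<lambda>z. u' (fst z) (snd z))"
    and partial_u: "\<And>i x \<tau>. \<tau> \<in> {s..t} \<Longrightarrow> has_partial i (\<lambda>y. u y \<tau>) x (pdx i u x \<tau>)"
    and partial_du: "\<And>i j x \<tau>. \<tau> \<in> {s..t} \<Longrightarrow>
      has_partial i (\<lambda>y. pdx j u y \<tau>) x (pdx i (pdx j u) x \<tau>)"
    and time_u: "\<And>x \<tau>. \<tau> \<in> {s..t} \<Longrightarrow> ((\<lambda>\<tau>. u x \<tau>) has_vector_derivative u' x \<tau>) (at \<tau> within {s..t})"
    and pde: "\<And>x \<tau>. \<tau> \<in> {s..t} \<Longrightarrow> u' x \<tau>
      - (\<Sum>i\<in>UNIV. \<Sum>j\<in>UNIV. pdx i (\<lambda>x t. a x t $ i $ j) x \<tau> * pdx j u x \<tau> + a x \<tau> $ i $ j * pdx i (pdx j u) x \<tau>)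
      + (\<Sum>i\<in>UNIV. b x \<tau> $ i * pdx i u x \<tau>) + c x \<tau> * u x \<tau> = 0"
    and growth_a: "\<And>i j x \<tau>. \<tau> \<in> {s..t} \<Longrightarrow> \<bar>a x \<tau> $ i $ j\<bar> \<le> C * (1 + (norm x)\<^sup>2)"
    and growth_da: "\<And>i j x \<tau>. \<tau> \<in> {s..t} \<Longrightarrow> \<bar>pdx i (\<lambda>x t. a x t $ i $ j) x \<tau>\<bar> \<le> C * (1 + norm x)"
    and growth_b: "\<And>i x \<tau>. \<tau> \<in> {s..t} \<Longrightarrow> \<bar>b x \<tau> $ i\<bar> \<le> C * (1 + norm x)"
    and C_nonneg: "0 \<le> C"
    and integrable_u: "integrable lborel (\<lambda>z. indicator {s..t} (snd z) * \<bar>u (fst z) (snd z)\<bar> powr q)"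
begin

definition sgn_power :: "real^'n \<Rightarrow> real \<Rightarrow> real" where
  "sgn_power x \<tau> = abs_pow (u x \<tau>) (q - 2) * u x \<tau>"

text \<open>This is \<open>div (a \<nabla>\<eta>) + b \<bullet> \<nabla>\<eta>\<close>, for given first and second derivatives of \<open>\<eta>\<close>.\<close>

definition cutoff_error :: "('n \<Rightarrow> real^'n \<Rightarrow> real) \<Rightarrow> ('n \<Rightarrow> 'n \<Rightarrow> real^'n \<Rightarrow> real) \<Rightarrow> real^'n \<Rightarrow> real \<Rightarrow> real" where
  "cutoff_error \<eta>1 \<eta>2 x \<tau> =
     (\<Sum>i\<in>UNIV. \<Sum>j\<in>UNIV. pdx i (\<lambda>x t. a x t $ i $ j) x \<tau> * \<eta>1 j x + a x \<tau> $ i $ j * \<eta>2 i j x)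
     + (\<Sum>i\<in>UNIV. b x \<tau> $ i * \<eta>1 i x)"

text \<open>Only the rules for algebraic operations: rules for powers and vector components would split the
  densities beyond the functions that are known to be continuous.\<close>

lemmas continuous_algebra =
  continuous_on_add continuous_on_diff continuous_on_mult continuous_on_sum continuous_on_minus continuous_on_const

lemma sgn_power_times_u: "sgn_power x \<tau> * u x \<tau> = \<bar>u x \<tau>\<bar> powr q"
  using abs_powr_eq_abs_pow[of "q - 2" "u x \<tau>"] q_ge_2 by (simp add: sgn_power_def)

lemma partial_powr_u:
  assumes "\<tau> \<in> {s..t}"
  shows "has_partial i (\<lambda>y. \<bar>u y \<tau>\<bar> powr q) x (q * sgn_power x \<tau> * pdx i u x \<tau>)"
  using has_partial_compose[OF has_derivative_abs_powr[of "q - 2"] partial_u[OF assms]] q_ge_2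
  by (simp add: sgn_power_def)

lemma partial_sgn_power:
  assumes "\<tau> \<in> {s..t}"
  shows "has_partial i (\<lambda>y. sgn_power y \<tau>) x ((q - 1) * abs_pow (u x \<tau>) (q - 2) * pdx i u x \<tau>)"
  using has_partial_compose[OF has_derivative_abs_pow_times_self[of "q - 2"] partial_u[OF assms]] q_ge_2
  by (simp add: sgn_power_def)

lemma time_powr_u:
  assumes "\<tau> \<in> {s..t}"
  shows "((\<lambda>\<tau>. \<bar>u x \<tau>\<bar> powr q) has_vector_derivative q * sgn_power x \<tau> * u' x \<tau>) (at \<tau> within {s..t})"
  using DERIV_chain2[where f = "\<lambda>y. \<bar>y\<bar> powr (q - 2 + 2)" and g = "u x",
      OF has_derivative_abs_powr, of "u' x \<tau>" \<tau> "{s..t}"]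
    time_u[OF assms, of x] q_ge_2
  by (simp add: sgn_power_def has_real_derivative_iff_has_vector_derivative)

lemma continuous_abs_pow_u:
  "continuous_on (UNIV \<times> {s..t}) (\<lambda>z. abs_pow (u (fst z) (snd z)) (q - 2))"
  using q_ge_2 by (intro continuous_on_compose2[OF continuous_abs_pow cont_u]) auto

lemma continuous_sgn_power:
  "continuous_on (UNIV \<times> {s..t}) (\<lambda>z. sgn_power (fst z) (snd z))"
  unfolding sgn_power_def by (intro continuous_algebra continuous_abs_pow_u cont_u)

lemma continuous_powr_u:
  "continuous_on (UNIV \<times> {s..t}) (\<lambda>z. \<bar>u (fst z) (snd z)\<bar> powr q)"
  unfolding sgn_power_times_u[symmetric] by (intro continuous_algebra continuous_sgn_power cont_u)

lemma continuous_gradient_density: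
  "continuous_on (UNIV \<times> {s..t}) (\<lambda>z. gradient_density q a u (fst z) (snd z))"
  unfolding gradient_density_def by (intro continuous_algebra continuous_abs_pow_u cont_a cont_du)

text \<open>The equation expresses \<open>c u\<close> through continuous functions, and \<open>c |u|\<^sup>q\<close> is \<open>c u\<close> times the continuous
  function \<open>|u|\<^sup>q\<^sup>-\<^sup>2 u\<close>.\<close>

lemma continuous_lower_order_density:
  "continuous_on (UNIV \<times> {s..t}) (\<lambda>z. lower_order_density q b c u (fst z) (snd z))"
proof (rule continuous_on_eq)
  let ?cu = "\<lambda>(x::real^'n) \<tau>. (\<Sum>i\<in>UNIV. \<Sum>j\<in>UNIV. pdx i (\<lambda>x t. a x t $ i $ j) x \<tau> * pdx j u x \<tau> + a x \<tau> $ i $ j * pdx i (pdx j u) x \<tau>)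
      - u' x \<tau> - (\<Sum>i\<in>UNIV. b x \<tau> $ i * pdx i u x \<tau>)"
  show "continuous_on (UNIV \<times> {s..t}) (\<lambda>z. - divergence b (fst z) (snd z) * \<bar>u (fst z) (snd z)\<bar> powr q
      + q * sgn_power (fst z) (snd z) * ?cu (fst z) (snd z))"
    unfolding divergence_def sgn_power_times_u[symmetric]
    by (intro continuous_algebra cont_u continuous_sgn_power cont_da cont_du cont_a cont_ddu cont_u' cont_b cont_db)
  fix z :: "(real^'n) \<times> real" assume "z \<in> UNIV \<times> {s..t}"
  then have cu: "?cu (fst z) (snd z) = c (fst z) (snd z) * u (fst z) (snd z)"
    using pde[of "snd z" "fst z"] by auto
  show "- divergence b (fst z) (snd z) * \<bar>u (fst z) (snd z)\<bar> powr q
      + q * sgn_power (fst z) (snd z) * ?cu (fst z) (snd z) = lower_order_density q b c u (fst z) (snd z)"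
    unfolding cu lower_order_density_def sgn_power_times_u[symmetric] by algebra
qed

lemma gradient_density_nonneg: "\<tau> \<in> {s..t} \<Longrightarrow> 0 \<le> gradient_density q a u x \<tau>"
  unfolding gradient_density_def by (intro mult_nonneg_nonneg abs_pow_nonneg elliptic)

lemma continuous_slice:
  assumes "continuous_on (UNIV \<times> {s..t}) (\<lambda>z. f (fst z) (snd z))" "\<tau> \<in> {s..t}"
  shows "continuous_on UNIV (\<lambda>x. f x \<tau>)"
  using assms(2) by (auto intro!: continuous_on_compose2[OF assms(1), of _ "\<lambda>x. (x, \<tau>)", simplified] continuous_intros)

text \<open>The balance law for \<open>w = \<eta> |u|\<^sup>q\<close> with the flux \<open>F\<close> below. The term \<open>- |u|\<^sup>q a \<nabla>\<eta>\<close> of the flux is what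
  moves the gradient from \<open>u\<close> to \<open>\<eta>\<close> in the cross terms.\<close>

lemma localized_energy_identity:
  fixes \<eta> :: "real^'n \<Rightarrow> real"
  assumes \<eta>: "\<And>i x. has_partial i \<eta> x (\<eta>1 i x)" "\<And>i j x. has_partial i (\<eta>1 j) x (\<eta>2 i j x)"
    and cont: "continuous_on UNIV \<eta>" "\<And>i. continuous_on UNIV (\<eta>1 i)" "\<And>i j. continuous_on UNIV (\<eta>2 i j)"
    and supp: "\<And>x. r < norm x \<Longrightarrow> \<eta> x = 0" "\<And>i x. r < norm x \<Longrightarrow> \<eta>1 i x = 0" "\<And>i j x. r < norm x \<Longrightarrow> \<eta>2 i j x = 0"
  shows "(\<integral>x. \<eta> x * \<bar>u x t\<bar> powr q \<partial>lborel) = (\<integral>x. \<eta> x * \<bar>u x s\<bar> powr q \<partial>lborel)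
    + (\<integral>z. indicator {s..t} (snd z) *
        (\<bar>u (fst z) (snd z)\<bar> powr q * cutoff_error \<eta>1 \<eta>2 (fst z) (snd z)
         - \<eta> (fst z) * (q * (q - 1) * gradient_density q a u (fst z) (snd z)
                          + lower_order_density q b c u (fst z) (snd z))) \<partial>lborel)"
proof -
  let ?K = "{s..t}" and ?p = "\<lambda>x \<tau>. abs_pow (u x \<tau>) (q - 2)"
    and ?da = "\<lambda>i j x \<tau>. pdx i (\<lambda>x t. a x t $ i $ j) x \<tau>"
  define U where "U x \<tau> = \<bar>u x \<tau>\<bar> powr q" for x \<tau>
  note partial_U = partial_powr_u[folded U_def] and time_U = time_powr_u[folded U_def]
    and continuous_U = continuous_powr_u[folded U_def] and sgn_power_times_u = sgn_power_times_u[folded U_def]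
  let ?A = "\<lambda>i x \<tau>. \<Sum>j\<in>UNIV. a x \<tau> $ i $ j * pdx j u x \<tau>" and ?N = "\<lambda>i x \<tau>. \<Sum>j\<in>UNIV. a x \<tau> $ i $ j * \<eta>1 j x"
    and ?S = "\<lambda>i x \<tau>. \<Sum>j\<in>UNIV. ?da i j x \<tau> * pdx j u x \<tau> + a x \<tau> $ i $ j * pdx i (pdx j u) x \<tau>"
    and ?M = "\<lambda>i x \<tau>. \<Sum>j\<in>UNIV. ?da i j x \<tau> * \<eta>1 j x + a x \<tau> $ i $ j * \<eta>2 i j x"
  define F where "F i x \<tau> = q * \<eta> x * sgn_power x \<tau> * ?A i x \<tau> - U x \<tau> * ?N i x \<tau> - \<eta> x * U x \<tau> * b x \<tau> $ i" for i x \<tau>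
  define F' where "F' i x \<tau> =
      (q * \<eta>1 i x * sgn_power x \<tau> + q * \<eta> x * ((q - 1) * ?p x \<tau> * pdx i u x \<tau>)) * ?A i x \<tau>
        + q * \<eta> x * sgn_power x \<tau> * ?S i x \<tau>
      - (q * sgn_power x \<tau> * pdx i u x \<tau> * ?N i x \<tau> + U x \<tau> * ?M i x \<tau>)
      - ((\<eta>1 i x * U x \<tau> + \<eta> x * (q * sgn_power x \<tau> * pdx i u x \<tau>)) * b x \<tau> $ i
         + \<eta> x * U x \<tau> * pdx i (\<lambda>x t. b x t $ i) x \<tau>)" for i x \<tau>
  define H where "H x \<tau> = U x \<tau> * cutoff_error \<eta>1 \<eta>2 x \<tau>
      - \<eta> x * (q * (q - 1) * gradient_density q a u x \<tau> + lower_order_density q b c u x \<tau>)" for x \<tau>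
  have cf: "continuous_on (UNIV \<times> ?K) (\<lambda>z. \<eta> (fst z))" "continuous_on (UNIV \<times> ?K) (\<lambda>z. \<eta>1 i (fst z))"
     "continuous_on (UNIV \<times> ?K) (\<lambda>z. \<eta>2 i j (fst z))" for i j
    by (rule continuous_on_compose2[OF cont(1)] continuous_on_compose2[OF cont(2)] continuous_on_compose2[OF cont(3)];
        auto intro!: continuous_intros)+
  have "(\<integral>x. \<eta> x * U x t \<partial>lborel) = (\<integral>x. \<eta> x * U x s \<partial>lborel)
      + (\<integral>z. indicator ?K (snd z) * H (fst z) (snd z) \<partial>lborel)"
  proof (rule balance_law_compact_support[where r = r, OF s_le_t])
    fix x \<tau> assume \<tau>: "\<tau> \<in> ?K"
    show "((\<lambda>\<tau>. \<eta> x * U x \<tau>) has_vector_derivative \<eta> x * (q * sgn_power x \<tau> * u' x \<tau>)) (at \<tau> within ?K)"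
      using time_U[OF \<tau>] by (rule has_vector_derivative_mult_right)
    show "\<eta> x * (q * sgn_power x \<tau> * u' x \<tau>) = (\<Sum>i\<in>UNIV. F' i x \<tau>) + H x \<tau>"
      using energy_balance_algebra[where \<eta> = "\<eta> x" and q = q and g = "sgn_power x \<tau>" and vt = "u' x \<tau>"
          and p = "?p x \<tau>" and ?\<eta>2.0 = "\<lambda>i j. \<eta>2 i j x" and ?\<eta>1.0 = "\<lambda>i. \<eta>1 i x",
          OF sym[OF \<tau>] sgn_power_times_u pde[OF \<tau>], of "\<lambda>i. pdx i (\<lambda>x t. b x t $ i) x \<tau>"]
      unfolding F'_def H_def cutoff_error_def gradient_density_def lower_order_density_def divergence_def U_def[symmetric]
      by (simp only: mult.assoc)
  next
    fix i x \<tau> assume \<tau>: "\<tau> \<in> ?K"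
    have A: "has_partial i (\<lambda>y. ?A i y \<tau>) x (?S i x \<tau>)"
      by (intro has_partial_sum has_partial_mult partial_a partial_du \<tau>)
    have N: "has_partial i (\<lambda>y. ?N i y \<tau>) x (?M i x \<tau>)"
      by (intro has_partial_sum has_partial_mult partial_a \<eta> \<tau>)
    have q\<eta>: "has_partial i (\<lambda>y. q * \<eta> y) x (q * \<eta>1 i x)"
      using has_partial_mult[OF has_partial_const \<eta>(1), of i q x] by simp
    show "has_partial i (\<lambda>y. F i y \<tau>) x (F' i x \<tau>)"
      unfolding F_def F'_def
      by (rule has_partial_diff[OF has_partial_diff[OF
            has_partial_mult[OF has_partial_mult[OF q\<eta> partial_sgn_power[OF \<tau>]] A]
            has_partial_mult[OF partial_U[OF \<tau>] N]]
            has_partial_mult[OF has_partial_mult[OF \<eta>(1) partial_U[OF \<tau>]] partial_b[OF \<tau>]]])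
  next
    fix \<tau> assume \<tau>: "\<tau> \<in> ?K"
    show "continuous_on UNIV (\<lambda>x. \<eta> x * U x \<tau>)"
      by (intro continuous_algebra cont continuous_slice[OF continuous_U \<tau>])
  next
    fix i \<tau> assume \<tau>: "\<tau> \<in> ?K"
    have "continuous_on (UNIV \<times> ?K) (\<lambda>z. F i (fst z) (snd z))"
      unfolding F_def by (intro continuous_algebra cf cont_a cont_du continuous_U continuous_sgn_power cont_b)
    then show "continuous_on UNIV (\<lambda>x. F i x \<tau>)"
      using \<tau> by (rule continuous_slice)
  next
    show "continuous_on (UNIV \<times> ?K) (\<lambda>z. F' i (fst z) (snd z))" for i
      unfolding F'_def
      by (intro continuous_algebra cf cont_a cont_da cont_du cont_ddu continuous_U continuous_sgn_power
          continuous_abs_pow_u cont_b cont_db)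
    show "continuous_on (UNIV \<times> ?K) (\<lambda>z. H (fst z) (snd z))"
      unfolding H_def cutoff_error_def
      by (intro continuous_algebra cf cont_a cont_da continuous_U cont_b
          continuous_gradient_density continuous_lower_order_density)
  qed (simp_all add: supp F_def F'_def H_def cutoff_error_def)
  then show ?thesis by (simp only: H_def U_def)
qed

text \<open>By the weighted bounds for the cutoff, each product of a coefficient with an entry of \<open>\<nabla>\<eta>\<close> is at most
  \<open>18 C\<close>, and each product with an entry of the Hessian of \<open>\<eta>\<close> at most \<open>60 C\<close>; hence \<open>78 = 18 + 60\<close>.\<close>

lemma cutoff_error_bounded:
  assumes "\<tau> \<in> {s..t}" "0 \<le> \<rho>" "\<rho> \<le> 1"
  shows "\<bar>cutoff_error (cutoff_grad \<rho>) (cutoff_hess \<rho>) x \<tau>\<bar> \<le> C * (78 * real CARD('n) ^ 2 + 18 * real CARD('n))"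
proof -
  have 1: "\<bar>f\<bar> * \<bar>cutoff_grad \<rho> j x\<bar> \<le> 18 * C" if "\<bar>f\<bar> \<le> C * (1 + norm x)" for f j
  proof -
    have "\<bar>f\<bar> * \<bar>cutoff_grad \<rho> j x\<bar> \<le> C * (1 + norm x) * \<bar>cutoff_grad \<rho> j x\<bar>"
      using that by (intro mult_right_mono) auto
    also have "\<dots> \<le> C * 18"
      unfolding mult.assoc using cutoff_grad_weighted_bound[OF assms(2,3)] C_nonneg by (intro mult_left_mono)
    finally show ?thesis by simp
  qed
  have 2: "\<bar>a x \<tau> $ i $ j\<bar> * \<bar>cutoff_hess \<rho> i j x\<bar> \<le> 60 * C" for i j
  proof -
    have "\<bar>a x \<tau> $ i $ j\<bar> * \<bar>cutoff_hess \<rho> i j x\<bar> \<le> C * (1 + (norm x)\<^sup>2) * \<bar>cutoff_hess \<rho> i j x\<bar>"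
      using growth_a[OF assms(1)] by (intro mult_right_mono) auto
    also have "\<dots> \<le> C * 60"
      unfolding mult.assoc using cutoff_hess_weighted_bound[OF assms(2,3)] C_nonneg by (intro mult_left_mono)
    finally show ?thesis by simp
  qed
  have "\<bar>pdx i (\<lambda>x t. a x t $ i $ j) x \<tau> * cutoff_grad \<rho> j x + a x \<tau> $ i $ j * cutoff_hess \<rho> i j x\<bar> \<le> 78 * C" for i j
    using 1[OF growth_da[OF assms(1)], of i j j] 2[of i j]
    by (intro order_trans[OF abs_triangle_ineq]) (simp add: abs_mult)
  then have "\<bar>\<Sum>i\<in>UNIV. \<Sum>j\<in>UNIV. pdx i (\<lambda>x t. a x t $ i $ j) x \<tau> * cutoff_grad \<rho> j x + a x \<tau> $ i $ j * cutoff_hess \<rho> i j x\<bar>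
     \<le> (\<Sum>i\<in>(UNIV::'n set). \<Sum>j\<in>(UNIV::'n set). 78 * C)"
    by (intro order_trans[OF sum_abs] sum_mono order_trans[OF sum_abs])
  moreover have "\<bar>\<Sum>i\<in>UNIV. b x \<tau> $ i * cutoff_grad \<rho> i x\<bar> \<le> (\<Sum>i\<in>(UNIV::'n set). 18 * C)"
    using 1[OF growth_b[OF assms(1)]] by (intro order_trans[OF sum_abs] sum_mono) (simp add: abs_mult)
  ultimately show ?thesis
    unfolding cutoff_error_def by (simp add: power2_eq_square algebra_simps)
qed

lemma tendsto_cutoff_error:
  "(\<lambda>\<rho>. cutoff_error (cutoff_grad \<rho>) (cutoff_hess \<rho>) x \<tau>) \<midarrow>0\<rightarrow> 0"
proof -
  have "(\<lambda>\<rho>. cutoff_error (cutoff_grad \<rho>) (cutoff_hess \<rho>) x \<tau>) \<midarrow>0\<rightarrow>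
    (\<Sum>i\<in>UNIV. \<Sum>j\<in>UNIV. pdx i (\<lambda>x t. a x t $ i $ j) x \<tau> * 0 + a x \<tau> $ i $ j * 0)
     + (\<Sum>i\<in>UNIV. b x \<tau> $ i * 0)"
    unfolding cutoff_error_def by (intro tendsto_intros tendsto_cutoff)
  then show ?thesis by simp
qed

end

context parabolic_solution
begin

section \<open>Removing the cutoff\<close>

lemma continuous_fst_strip:
  fixes f :: "real^'n \<Rightarrow> real"
  assumes "continuous_on UNIV f"
  shows "continuous_on (UNIV \<times> {s..t}) (\<lambda>z. f (fst z))"
  by (rule continuous_on_compose2[OF assms]) (auto intro!: continuous_intros)

lemma cutoff_energy_balance:
  assumes \<rho>: "0 < \<rho>"
  shows "(\<integral>\<^sup>+x. ennreal (cutoff \<rho> x * \<bar>u x t\<bar> powr q) \<partial>lborel)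
     + (\<integral>\<^sup>+z. ennreal (cutoff \<rho> (fst z) *
          (indicator {s..t} (snd z) * (q * (q - 1) * gradient_density q a u (fst z) (snd z)))) \<partial>lborel)
     + (\<integral>\<^sup>+z. ennreal (cutoff \<rho> (fst z) *
          (indicator {s..t} (snd z) * lower_order_density q b c u (fst z) (snd z))) \<partial>lborel)
     + (\<integral>\<^sup>+z. ennreal (- (indicator {s..t} (snd z) *
          (\<bar>u (fst z) (snd z)\<bar> powr q * cutoff_error (cutoff_grad \<rho>) (cutoff_hess \<rho>) (fst z) (snd z)))) \<partial>lborel)
   = (\<integral>\<^sup>+x. ennreal (cutoff \<rho> x * \<bar>u x s\<bar> powr q) \<partial>lborel)
     + (\<integral>\<^sup>+z. ennreal (- (cutoff \<rho> (fst z) *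
          (indicator {s..t} (snd z) * lower_order_density q b c u (fst z) (snd z)))) \<partial>lborel)
     + (\<integral>\<^sup>+z. ennreal (indicator {s..t} (snd z) *
          (\<bar>u (fst z) (snd z)\<bar> powr q * cutoff_error (cutoff_grad \<rho>) (cutoff_hess \<rho>) (fst z) (snd z))) \<partial>lborel)"
    (is "?NA + ?NG + ?NL + ?NE = ?NB + ?NL' + ?NE'")
proof -
  let ?k = "\<lambda>z::(real^'n) \<times> real. indicator {s..t} (snd z) :: real"
  let ?G = "\<lambda>z. cutoff \<rho> (fst z) * (?k z * (q * (q - 1) * gradient_density q a u (fst z) (snd z)))"
    and ?L = "\<lambda>z. cutoff \<rho> (fst z) * (?k z * lower_order_density q b c u (fst z) (snd z))"
    and ?E = "\<lambda>z. ?k z * (\<bar>u (fst z) (snd z)\<bar> powr q * cutoff_error (cutoff_grad \<rho>) (cutoff_hess \<rho>) (fst z) (snd z))"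
  note cf = continuous_fst_strip[OF continuous_cutoff(1)] continuous_fst_strip[OF continuous_cutoff(2)]
    continuous_fst_strip[OF continuous_cutoff(3)]
  note supp = cutoff_support[OF \<rho>]
  have intA: "integrable lborel (\<lambda>x. cutoff \<rho> x * \<bar>u x \<tau>\<bar> powr q)" if "\<tau> \<in> {s..t}" for \<tau>
  proof (rule integrable_compact_support[of "cball 0 (1 / sqrt \<rho>)"])
    show "continuous_on (cball 0 (1 / sqrt \<rho>)) (\<lambda>x. cutoff \<rho> x * \<bar>u x \<tau>\<bar> powr q)"
      by (intro continuous_on_mult continuous_cutoff continuous_on_subset[OF continuous_slice[OF continuous_powr_u that]]) auto
    show "cutoff \<rho> x * \<bar>u x \<tau>\<bar> powr q = 0" if "x \<notin> cball 0 (1 / sqrt \<rho>)" for x :: "real^'n"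
    proof -
      have "1 / sqrt \<rho> < norm x" using that by (simp add: not_le)
      then show ?thesis by (simp add: supp(1))
    qed
  qed simp
  have intG: "integrable lborel ?G"
  proof -
    have "integrable lborel (\<lambda>z. ?k z * (cutoff \<rho> (fst z) * (q * (q - 1) * gradient_density q a u (fst z) (snd z))))"
      by (rule integrable_strip_compact_support[where r = "1 / sqrt \<rho>"];
          (intro continuous_algebra cf continuous_gradient_density | simp add: supp))
    then show ?thesis by (simp only: mult.left_commute)
  qed
  have intL: "integrable lborel ?L"
  proof -
    have "integrable lborel (\<lambda>z. ?k z * (cutoff \<rho> (fst z) * lower_order_density q b c u (fst z) (snd z)))"
      by (rule integrable_strip_compact_support[where r = "1 / sqrt \<rho>"];
          (intro continuous_algebra cf continuous_lower_order_density | simp add: supp))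
    then show ?thesis by (simp only: mult.left_commute)
  qed
  have intE: "integrable lborel ?E"
  proof (rule integrable_strip_compact_support[where r = "1 / sqrt \<rho>"])
    show "continuous_on (UNIV \<times> {s..t}) (\<lambda>z. \<bar>u (fst z) (snd z)\<bar> powr q * cutoff_error (cutoff_grad \<rho>) (cutoff_hess \<rho>) (fst z) (snd z))"
      unfolding cutoff_error_def
      by (intro continuous_on_mult continuous_powr_u) (intro continuous_algebra cf cont_a cont_da cont_b)
  qed (simp add: cutoff_error_def supp)
  have "(\<integral>x. cutoff \<rho> x * \<bar>u x t\<bar> powr q \<partial>lborel) = (\<integral>x. cutoff \<rho> x * \<bar>u x s\<bar> powr q \<partial>lborel)
    + (\<integral>z. ?k z * (\<bar>u (fst z) (snd z)\<bar> powr q * cutoff_error (cutoff_grad \<rho>) (cutoff_hess \<rho>) (fst z) (snd z)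
         - cutoff \<rho> (fst z) * (q * (q - 1) * gradient_density q a u (fst z) (snd z)
                          + lower_order_density q b c u (fst z) (snd z))) \<partial>lborel)"
    by (rule localized_energy_identity[where r = "1 / sqrt \<rho>"])
       (simp_all add: has_partial_cutoff has_partial_cutoff_grad continuous_cutoff supp)
  also have "(\<lambda>z. ?k z * (\<bar>u (fst z) (snd z)\<bar> powr q * cutoff_error (cutoff_grad \<rho>) (cutoff_hess \<rho>) (fst z) (snd z)
         - cutoff \<rho> (fst z) * (q * (q - 1) * gradient_density q a u (fst z) (snd z)
                          + lower_order_density q b c u (fst z) (snd z)))) = (\<lambda>z. ?E z - ?G z - ?L z)"
    by (simp add: fun_eq_iff algebra_simps)
  also have "integral\<^sup>L lborel (\<lambda>z. ?E z - ?G z - ?L z) = integral\<^sup>L lborel ?E - integral\<^sup>L lborel ?G - integral\<^sup>L lborel ?L"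
    using intE intG intL by (simp only: Bochner_Integration.integral_diff Bochner_Integration.integrable_diff)
  finally have "(\<integral>x. cutoff \<rho> x * \<bar>u x t\<bar> powr q \<partial>lborel) + integral\<^sup>L lborel ?G + integral\<^sup>L lborel ?L
     = (\<integral>x. cutoff \<rho> x * \<bar>u x s\<bar> powr q \<partial>lborel) + integral\<^sup>L lborel ?E"
    by linarith
  then show ?thesis
  proof (subst signed_balance_iff[OF intA intA intG intL intE])
    show "0 \<le> ?G z" for z
      using gradient_density_nonneg[of "snd z" "fst z"] q_ge_2
      by (auto simp: indicator_def intro!: mult_nonneg_nonneg cutoff_nonneg)
  qed (use s_le_t in \<open>simp_all add: cutoff_nonneg\<close>)
qed

text \<open>The integrands are dominated by a multiple of \<open>|u|\<^sup>q\<close> on the strip and tend to zero pointwise. The sign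
  \<open>\<sigma>\<close> covers the positive and the negative part of the error at once.\<close>

lemma tendsto_nn_integral_cutoff_error:
  assumes \<sigma>: "\<bar>\<sigma>\<bar> = (1::real)"
  shows "(\<lambda>m. \<integral>\<^sup>+z. ennreal (\<sigma> * (indicator {s..t} (snd z) * (\<bar>u (fst z) (snd z)\<bar> powr q *
       cutoff_error (cutoff_grad (1 / real (Suc m))) (cutoff_hess (1 / real (Suc m))) (fst z) (snd z)))) \<partial>lborel) \<longlonglongrightarrow> 0"
proof -
  let ?k = "\<lambda>z::(real^'n) \<times> real. indicator {s..t} (snd z) :: real"
  let ?E = "\<lambda>m z. ?k z * (\<bar>u (fst z) (snd z)\<bar> powr q *
       cutoff_error (cutoff_grad (1 / real (Suc m))) (cutoff_hess (1 / real (Suc m))) (fst z) (snd z))"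
  define B where "B = C * (78 * real CARD('n) ^ 2 + 18 * real CARD('n))"
  have B: "0 \<le> B" using C_nonneg by (simp add: B_def)
  note cf = continuous_fst_strip[OF continuous_cutoff(1)] continuous_fst_strip[OF continuous_cutoff(2)]
    continuous_fst_strip[OF continuous_cutoff(3)]
  have meas: "?E m \<in> borel_measurable borel" for m
  proof (rule measurable_strip)
    show "continuous_on (UNIV \<times> {s..t}) (\<lambda>z. \<bar>u (fst z) (snd z)\<bar> powr q *
        cutoff_error (cutoff_grad (1 / real (Suc m))) (cutoff_hess (1 / real (Suc m))) (fst z) (snd z))"
      unfolding cutoff_error_def
      by (intro continuous_on_mult continuous_powr_u) (intro continuous_algebra cf cont_a cont_da cont_b)
  qed
  have "(\<lambda>m. \<integral>\<^sup>+z. ennreal (\<sigma> * ?E m z) \<partial>lborel) \<longlonglongrightarrow> (\<integral>\<^sup>+z. 0 \<partial>(lborel :: ((real^'n) \<times> real) measure))"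
  proof (rule nn_integral_dominated_convergence)
    show "(\<lambda>z. ennreal (\<sigma> * ?E m z)) \<in> borel_measurable lborel" for m
      using meas[of m] by simp
    show "(\<lambda>z. ennreal (B * (?k z * \<bar>u (fst z) (snd z)\<bar> powr q))) \<in> borel_measurable lborel"
      using borel_measurable_integrable[OF integrable_u] by simp
    show "(\<integral>\<^sup>+z. ennreal (B * (?k z * \<bar>u (fst z) (snd z)\<bar> powr q)) \<partial>lborel) < \<infinity>"
      using integrable_u B
      by (subst nn_integral_eq_integral) (auto intro!: integrable_mult_right AE_I2 mult_nonneg_nonneg)
    show "AE z in lborel. ennreal (\<sigma> * ?E m z) \<le> ennreal (B * (?k z * \<bar>u (fst z) (snd z)\<bar> powr q))" for m
    proof (intro AE_I2 ennreal_leI)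
      fix z :: "(real^'n) \<times> real"
      have "\<sigma> * ?E m z \<le> \<bar>\<sigma> * ?E m z\<bar>" by simp
      also have "\<dots> = ?k z * \<bar>u (fst z) (snd z)\<bar> powr q *
          \<bar>cutoff_error (cutoff_grad (1 / real (Suc m))) (cutoff_hess (1 / real (Suc m))) (fst z) (snd z)\<bar>"
        using \<sigma> by (simp add: abs_mult mult.assoc)
      also have "\<dots> \<le> ?k z * \<bar>u (fst z) (snd z)\<bar> powr q * B"
        using cutoff_error_bounded[of "snd z" "1 / real (Suc m)" "fst z"]
        by (cases "snd z \<in> {s..t}") (auto simp: B_def intro!: mult_left_mono)
      finally show "\<sigma> * ?E m z \<le> B * (?k z * \<bar>u (fst z) (snd z)\<bar> powr q)"
        by (simp add: ac_simps)
    qed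
    show "AE z in lborel. (\<lambda>m. ennreal (\<sigma> * ?E m z)) \<longlonglongrightarrow> 0"
    proof (rule AE_I2)
      fix z :: "(real^'n) \<times> real"
      from filterlim_compose[OF tendsto_cutoff_error filterlim_inverse_Suc_at_0]
      have "(\<lambda>m. \<sigma> * ?E m z) \<longlonglongrightarrow> \<sigma> * (?k z * (\<bar>u (fst z) (snd z)\<bar> powr q * 0))"
        by (intro tendsto_mult tendsto_const)
      then have "(\<lambda>m. \<sigma> * ?E m z) \<longlonglongrightarrow> 0" by simp
      then show "(\<lambda>m. ennreal (\<sigma> * ?E m z)) \<longlonglongrightarrow> 0"
        using tendsto_ennrealI by fastforce
    qed
  qed simp
  then show ?thesis by simp
qed

text \<open>The limit \<open>\<rho> \<rightarrow> 0\<close> of the localized identity, taken in \<open>[0,\<infinity>]\<close> because any of the terms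
  may be infinite in the limit: the densities, split into positive and negative parts, by monotone
  convergence, and the error term by dominated convergence.\<close>

lemma energy_identity_strip:
  "(\<integral>\<^sup>+x. ennreal (\<bar>u x t\<bar> powr q) \<partial>lborel)
     + ennreal (q * (q - 1)) * (\<integral>\<^sup>+z. ennreal (indicator {s..t} (snd z) * gradient_density q a u (fst z) (snd z)) \<partial>lborel)
     + (\<integral>\<^sup>+z. ennreal (indicator {s..t} (snd z) * lower_order_density q b c u (fst z) (snd z)) \<partial>lborel)
   = (\<integral>\<^sup>+x. ennreal (\<bar>u x s\<bar> powr q) \<partial>lborel)
     + (\<integral>\<^sup>+z. ennreal (- (indicator {s..t} (snd z) * lower_order_density q b c u (fst z) (snd z))) \<partial>lborel)"
proof -
  let ?k = "\<lambda>z::(real^'n) \<times> real. indicator {s..t} (snd z) :: real"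
  let ?\<rho> = "\<lambda>m. 1 / real (Suc m)"
  let ?G = "\<lambda>z. ?k z * (q * (q - 1) * gradient_density q a u (fst z) (snd z))"
    and ?L = "\<lambda>z. ?k z * lower_order_density q b c u (fst z) (snd z)"
    and ?E = "\<lambda>m z. ?k z * (\<bar>u (fst z) (snd z)\<bar> powr q * cutoff_error (cutoff_grad (?\<rho> m)) (cutoff_hess (?\<rho> m)) (fst z) (snd z))"
  have meas: "?G \<in> borel_measurable borel" "?L \<in> borel_measurable borel"
    by (intro measurable_strip continuous_algebra continuous_gradient_density continuous_lower_order_density)+
  have meas_slice: "(\<lambda>x. \<bar>u x \<tau>\<bar> powr q) \<in> borel_measurable borel" if "\<tau> \<in> {s..t}" for \<tau>
    using continuous_slice[OF continuous_powr_u that] by (rule borel_measurable_continuous_onI)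
  note limA = tendsto_nn_integral_cutoff[OF meas_slice continuous_on_id]
  note limz = tendsto_nn_integral_cutoff[OF _ continuous_on_fst[OF continuous_on_id]]
  have "(\<lambda>m. (\<integral>\<^sup>+x. ennreal (cutoff (?\<rho> m) x * \<bar>u x t\<bar> powr q) \<partial>lborel)
       + (\<integral>\<^sup>+z. ennreal (cutoff (?\<rho> m) (fst z) * ?G z) \<partial>lborel) + (\<integral>\<^sup>+z. ennreal (cutoff (?\<rho> m) (fst z) * ?L z) \<partial>lborel)
       + (\<integral>\<^sup>+z. ennreal (- ?E m z) \<partial>lborel))
     \<longlonglongrightarrow> (\<integral>\<^sup>+x. ennreal (\<bar>u x t\<bar> powr q) \<partial>lborel) + (\<integral>\<^sup>+z. ennreal (?G z) \<partial>lborel)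
       + (\<integral>\<^sup>+z. ennreal (?L z) \<partial>lborel) + 0"
    using tendsto_nn_integral_cutoff_error[of "-1"] s_le_t
    by (intro tendsto_add limA limz meas) simp_all
  moreover have "(\<lambda>m. (\<integral>\<^sup>+x. ennreal (cutoff (?\<rho> m) x * \<bar>u x s\<bar> powr q) \<partial>lborel)
       + (\<integral>\<^sup>+z. ennreal (cutoff (?\<rho> m) (fst z) * - ?L z) \<partial>lborel) + (\<integral>\<^sup>+z. ennreal (?E m z) \<partial>lborel))
     \<longlonglongrightarrow> (\<integral>\<^sup>+x. ennreal (\<bar>u x s\<bar> powr q) \<partial>lborel) + (\<integral>\<^sup>+z. ennreal (- ?L z) \<partial>lborel) + 0"
    using tendsto_nn_integral_cutoff_error[of 1] s_le_t meas
    by (intro tendsto_add limA limz borel_measurable_uminus) simp_all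
  moreover have "(\<integral>\<^sup>+x. ennreal (cutoff (?\<rho> m) x * \<bar>u x t\<bar> powr q) \<partial>lborel)
       + (\<integral>\<^sup>+z. ennreal (cutoff (?\<rho> m) (fst z) * ?G z) \<partial>lborel) + (\<integral>\<^sup>+z. ennreal (cutoff (?\<rho> m) (fst z) * ?L z) \<partial>lborel)
       + (\<integral>\<^sup>+z. ennreal (- ?E m z) \<partial>lborel)
     = (\<integral>\<^sup>+x. ennreal (cutoff (?\<rho> m) x * \<bar>u x s\<bar> powr q) \<partial>lborel)
       + (\<integral>\<^sup>+z. ennreal (cutoff (?\<rho> m) (fst z) * - ?L z) \<partial>lborel) + (\<integral>\<^sup>+z. ennreal (?E m z) \<partial>lborel)" for m
    using cutoff_energy_balance[of "?\<rho> m"] by (simp only: mult_minus_right) simp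
  ultimately have "(\<integral>\<^sup>+x. ennreal (\<bar>u x t\<bar> powr q) \<partial>lborel) + (\<integral>\<^sup>+z. ennreal (?G z) \<partial>lborel) + (\<integral>\<^sup>+z. ennreal (?L z) \<partial>lborel) + 0
     = (\<integral>\<^sup>+x. ennreal (\<bar>u x s\<bar> powr q) \<partial>lborel) + (\<integral>\<^sup>+z. ennreal (- ?L z) \<partial>lborel) + 0"
    by (simp only: LIMSEQ_unique)
  moreover have "(\<integral>\<^sup>+z. ennreal (?G z) \<partial>lborel)
     = ennreal (q * (q - 1)) * (\<integral>\<^sup>+z. ennreal (?k z * gradient_density q a u (fst z) (snd z)) \<partial>lborel)"
  proof -
    have "(\<integral>\<^sup>+z. ennreal (?G z) \<partial>lborel)
       = (\<integral>\<^sup>+z. ennreal (q * (q - 1)) * ennreal (?k z * gradient_density q a u (fst z) (snd z)) \<partial>lborel)"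
      using q_ge_2 by (intro nn_integral_cong) (simp add: ennreal_mult'[symmetric] mult.left_commute)
    also have "\<dots> = ennreal (q * (q - 1)) * (\<integral>\<^sup>+z. ennreal (?k z * gradient_density q a u (fst z) (snd z)) \<partial>lborel)"
      using measurable_strip[OF continuous_gradient_density] by (intro nn_integral_cmult) simp
    finally show ?thesis .
  qed
  ultimately show ?thesis by simp
qed

lemma extended_energy_identity: "energy_identity_ext q a b c u s t"
  unfolding energy_identity_ext_def
  using energy_identity_strip
  by (simp add: nn_integral_strip[OF continuous_gradient_density] nn_integral_strip[OF continuous_lower_order_density]
      nn_integral_strip[OF continuous_on_minus[OF continuous_lower_order_density]])

text \<open>Finiteness of the right-hand side of the extended identity forces every term on the left to be
  finite; all densities are then integrable and the identity can be read in the reals.\<close>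

lemma finite_energy_identity:
  assumes "(\<integral>\<^sup>+x. ennreal (\<bar>u x s\<bar> powr q) \<partial>lborel) < \<infinity>"
    and "(\<integral>\<^sup>+\<tau>\<in>{s..t}. (\<integral>\<^sup>+x. ennreal (- lower_order_density q b c u x \<tau>) \<partial>lborel) \<partial>lborel) < \<infinity>"
  shows "energy_identity_finite q a b c u s t"
proof -
  let ?k = "\<lambda>z::(real^'n) \<times> real. indicator {s..t} (snd z) :: real"
  let ?G = "\<lambda>z. ?k z * gradient_density q a u (fst z) (snd z)"
    and ?L = "\<lambda>z. ?k z * lower_order_density q b c u (fst z) (snd z)"
  have neg: "(\<integral>\<^sup>+z. ennreal (- ?L z) \<partial>lborel) < \<infinity>"
    using assms(2) by (simp add: nn_integral_strip[OF continuous_on_minus[OF continuous_lower_order_density]])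
  have c: "0 < q * (q - 1)" using q_ge_2 by simp
  have "(\<integral>\<^sup>+x. ennreal (\<bar>u x t\<bar> powr q) \<partial>lborel) + ennreal (q * (q - 1)) * (\<integral>\<^sup>+z. ennreal (?G z) \<partial>lborel)
      + (\<integral>\<^sup>+z. ennreal (?L z) \<partial>lborel) < \<infinity>"
    using assms(1) neg unfolding energy_identity_strip by simp
  then have fin: "(\<integral>\<^sup>+x. ennreal (\<bar>u x t\<bar> powr q) \<partial>lborel) < \<infinity>" "(\<integral>\<^sup>+z. ennreal (?G z) \<partial>lborel) < \<infinity>"
      "(\<integral>\<^sup>+z. ennreal (?L z) \<partial>lborel) < \<infinity>"
    using c by (auto simp: ennreal_mult_less_top)
  have meas: "?G \<in> borel_measurable borel" "?L \<in> borel_measurable borel"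
    by (intro measurable_strip continuous_gradient_density continuous_lower_order_density)+
  have meas_slice: "(\<lambda>x. \<bar>u x \<tau>\<bar> powr q) \<in> borel_measurable borel" if "\<tau> \<in> {s..t}" for \<tau>
    using continuous_slice[OF continuous_powr_u that] by (rule borel_measurable_continuous_onI)
  have G: "0 \<le> ?G z" for z
    using gradient_density_nonneg[of "snd z" "fst z"] by (auto simp: indicator_def)
  have int: "integrable lborel (\<lambda>x. \<bar>u x t\<bar> powr q)" "integrable lborel (\<lambda>x. \<bar>u x s\<bar> powr q)"
    "integrable lborel ?G"
    using fin assms(1) meas meas_slice s_le_t G by (auto intro!: integrableI_nonneg)
  have intL: "integrable lborel ?L"
    using meas fin neg by (auto simp: real_integrable_def)
  have intcG: "integrable lborel (\<lambda>z. q * (q - 1) * ?G z)"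
    using int(3) by (rule integrable_mult_right)
  have cG: "(\<integral>\<^sup>+z. ennreal (q * (q - 1) * ?G z) \<partial>lborel) = ennreal (q * (q - 1)) * (\<integral>\<^sup>+z. ennreal (?G z) \<partial>lborel)"
    using c G meas(1) by (simp only: ennreal_mult less_imp_le) (auto intro!: nn_integral_cmult)
  have "(\<integral>x. \<bar>u x t\<bar> powr q \<partial>lborel) + (\<integral>z. q * (q - 1) * ?G z \<partial>lborel) + integral\<^sup>L lborel ?L
      = (\<integral>x. \<bar>u x s\<bar> powr q \<partial>lborel) + (\<integral>z. 0 \<partial>(lborel :: ((real^'n) \<times> real) measure))"
  proof (rule signed_balance_iff[THEN iffD1, OF int(1,2) intcG intL])
    show "(\<integral>\<^sup>+x. ennreal (\<bar>u x t\<bar> powr q) \<partial>lborel) + (\<integral>\<^sup>+z. ennreal (q * (q - 1) * ?G z) \<partial>lborel)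
        + (\<integral>\<^sup>+z. ennreal (?L z) \<partial>lborel) + (\<integral>\<^sup>+z. ennreal (- 0) \<partial>(lborel :: ((real^'n) \<times> real) measure))
      = (\<integral>\<^sup>+x. ennreal (\<bar>u x s\<bar> powr q) \<partial>lborel) + (\<integral>\<^sup>+z. ennreal (- ?L z) \<partial>lborel)
        + (\<integral>\<^sup>+z. ennreal 0 \<partial>(lborel :: ((real^'n) \<times> real) measure))"
      using energy_identity_strip by (simp add: cG)
    show "0 \<le> q * (q - 1) * ?G z" for z
      by (rule mult_nonneg_nonneg[OF less_imp_le[OF c] G])
  qed auto
  then show ?thesis
    unfolding energy_identity_finite_def integral_strip(2)[OF int(3)] integral_strip(2)[OF intL]
    using int(1,2) integral_strip(1)[OF int(3)] integral_strip(1)[OF intL] by simp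
qed

end

section \<open>The energy identity\<close>

lemma uniform_growth_bound:
  fixes f :: "'i::finite \<Rightarrow> real^'n::finite \<Rightarrow> real \<Rightarrow> real"
  assumes "\<And>i. growth_O I k (f i)" "compact K" "K \<subseteq> I"
    and "\<And>i. continuous_on (UNIV \<times> K) (\<lambda>z. f i (fst z) (snd z))"
  obtains C where "0 \<le> C" "\<And>i x t. t \<in> K \<Longrightarrow> \<bar>f i x t\<bar> \<le> C * (1 + norm x ^ k)"
proof -
  have "\<exists>C\<ge>0. \<forall>x. \<forall>t\<in>K. norm (f i x t) \<le> C * (1 + norm x ^ k)" for i
    using growth_O_bound[OF assms(1)[of i] assms(2,3) assms(4)[of i]] by metis
  then obtain C where C: "\<And>i. 0 \<le> C i" "\<And>i x t. t \<in> K \<Longrightarrow> norm (f i x t) \<le> C i * (1 + norm x ^ k)"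
    by metis
  show thesis
  proof
    show "0 \<le> (\<Sum>i\<in>UNIV. C i)" by (intro sum_nonneg C)
    fix i x t assume "t \<in> K"
    then have "\<bar>f i x t\<bar> \<le> C i * (1 + norm x ^ k)" using C(2) by simp
    also have "\<dots> \<le> (\<Sum>i\<in>UNIV. C i) * (1 + norm x ^ k)"
      by (intro mult_right_mono member_le_sum C) auto
    finally show "\<bar>f i x t\<bar> \<le> (\<Sum>i\<in>UNIV. C i) * (1 + norm x ^ k)" .
  qed
qed

theorem theorem1p3:
  fixes I :: "real set"
    and a :: "real^'n::finite \<Rightarrow> real \<Rightarrow> real^'n^'n"
    and b :: "real^'n \<Rightarrow> real \<Rightarrow> real^'n"
    and c u :: "real^'n \<Rightarrow> real \<Rightarrow> real"
    and q s t :: real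
  assumes "is_interval I"
    and "(\<lambda>(x, t). a x t) \<in> borel_measurable (lebesgue_on (UNIV \<times> I))"
    and "(\<lambda>(x, t). b x t) \<in> borel_measurable (lebesgue_on (UNIV \<times> I))"
    and "(\<lambda>(x, t). c x t) \<in> borel_measurable (lebesgue_on (UNIV \<times> I))"
    and "\<And>i j. Ckl 1 0 I (\<lambda>x t. a x t $ i $ j)"
    and "\<And>i j x t. t \<in> I \<Longrightarrow> a x t $ i $ j = a x t $ j $ i"
    and "\<exists>\<theta>>0. \<forall>\<xi> x. \<forall>t\<in>I.
           (\<Sum>i\<in>UNIV. \<Sum>j\<in>UNIV. a x t $ i $ j * \<xi> $ i * \<xi> $ j) \<ge> \<theta> * (norm \<xi>)\<^sup>2"
    and "\<And>i j. growth_O I 2 (\<lambda>x t. a x t $ i $ j)"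
    and "\<And>i j. growth_O I 1 (pdx i (\<lambda>x t. a x t $ i $ j))"
    and "\<And>j. Ckl 1 0 I (\<lambda>x t. b x t $ j)"
    and "growth_O I 1 b"
    and "Ckl 2 1 I u"
    and "\<And>x t. t \<in> I \<Longrightarrow>
           pdt I u x t
           - (\<Sum>i\<in>UNIV. \<Sum>j\<in>UNIV. pdx i (\<lambda>x t. a x t $ i $ j * pdx j u x t) x t)
           + b x t \<bullet> grad u x t + c x t * u x t = 0"
    and "q \<ge> 2"
    and "in_Lp q (UNIV \<times> I) (\<lambda>(x, t). u x t)"
    and "s \<in> I" and "t \<in> I" and "s \<le> t"
  shows "energy_identity_ext q a b c u s t \<and>
         ((\<integral>\<^sup>+x. ennreal (\<bar>u x s\<bar> powr q) \<partial>lborel) < \<infinity> \<and>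
          (\<integral>\<^sup>+\<tau>\<in>{s..t}. (\<integral>\<^sup>+x. ennreal (- lower_order_density q b c u x \<tau>) \<partial>lborel) \<partial>lborel) < \<infinity>
          \<longrightarrow> energy_identity_finite q a b c u s t)"
proof -
  let ?K = "{s..t}"
  have KI: "?K \<subseteq> I"
    using mem_is_interval_1_I[OF assms(1,16,17)] by auto
  have on_K: "continuous_on (UNIV \<times> ?K) (\<lambda>z. f (fst z) (snd z))"
    if "continuous_on (UNIV \<times> I) (\<lambda>(x, t). f x t)" for f :: "real^'n \<Rightarrow> real \<Rightarrow> real"
    using that KI by (auto simp: case_prod_beta' intro: continuous_on_subset)
  have a: "continuous_on (UNIV \<times> ?K) (\<lambda>z. a (fst z) (snd z) $ i $ j)"
      "continuous_on (UNIV \<times> ?K) (\<lambda>z. pdx i (\<lambda>x t. a x t $ i $ j) (fst z) (snd z))"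
      "\<And>x \<tau>. \<tau> \<in> ?K \<Longrightarrow> has_partial i (\<lambda>y. a y \<tau> $ i $ j) x (pdx i (\<lambda>x t. a x t $ i $ j) x \<tau>)" for i j
    using assms(5)[of i j] KI
    by (auto simp: Ckl_def intro!: on_K[of "\<lambda>x t. a x t $ i $ j"] on_K[of "pdx i (\<lambda>x t. a x t $ i $ j)"] has_partial_pdxI)
  have b: "continuous_on (UNIV \<times> ?K) (\<lambda>z. b (fst z) (snd z) $ i)"
      "continuous_on (UNIV \<times> ?K) (\<lambda>z. pdx i (\<lambda>x t. b x t $ i) (fst z) (snd z))"
      "\<And>x \<tau>. \<tau> \<in> ?K \<Longrightarrow> has_partial i (\<lambda>y. b y \<tau> $ i) x (pdx i (\<lambda>x t. b x t $ i) x \<tau>)" for i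
    using assms(10)[of i] KI
    by (auto simp: Ckl_def intro!: on_K[of "\<lambda>x t. b x t $ i"] on_K[of "pdx i (\<lambda>x t. b x t $ i)"] has_partial_pdxI)
  have u: "continuous_on (UNIV \<times> ?K) (\<lambda>z. u (fst z) (snd z))"
      "continuous_on (UNIV \<times> ?K) (\<lambda>z. pdt I u (fst z) (snd z))"
      "\<And>i. continuous_on (UNIV \<times> ?K) (\<lambda>z. pdx i u (fst z) (snd z))"
      "\<And>i j. continuous_on (UNIV \<times> ?K) (\<lambda>z. pdx i (pdx j u) (fst z) (snd z))"
      "\<And>i x \<tau>. \<tau> \<in> ?K \<Longrightarrow> has_partial i (\<lambda>y. u y \<tau>) x (pdx i u x \<tau>)"
      "\<And>i j x \<tau>. \<tau> \<in> ?K \<Longrightarrow> has_partial i (\<lambda>y. pdx j u y \<tau>) x (pdx i (pdx j u) x \<tau>)"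
    using assms(12) KI by (auto simp: Ckl_def numeral_2_eq_2 intro!: on_K has_partial_pdxI)
  have time: "((\<lambda>\<tau>. u x \<tau>) has_vector_derivative pdt I u x \<tau>) (at \<tau> within ?K)" if "\<tau> \<in> ?K" for x \<tau>
  proof -
    have "(\<lambda>\<tau>. u x \<tau>) differentiable (at \<tau> within I)"
      using assms(12) KI that by (auto simp: Ckl_def)
    then have "((\<lambda>\<tau>. u x \<tau>) has_vector_derivative pdt I u x \<tau>) (at \<tau> within I)"
      unfolding pdt_def by (simp add: vector_derivative_works)
    then show ?thesis
      using KI by (rule has_vector_derivative_within_subset)
  qed
  obtain C1 where C1: "0 \<le> C1" "\<And>p x \<tau>. \<tau> \<in> ?K \<Longrightarrow> \<bar>a x \<tau> $ fst p $ snd p\<bar> \<le> C1 * (1 + norm x ^ 2)"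
    using uniform_growth_bound[of I 2 "\<lambda>p x t. a x t $ fst p $ snd p" ?K] assms(8) KI a(1) by auto
  obtain C2 where C2: "0 \<le> C2" "\<And>p x \<tau>. \<tau> \<in> ?K \<Longrightarrow>
      \<bar>pdx (fst p) (\<lambda>x t. a x t $ fst p $ snd p) x \<tau>\<bar> \<le> C2 * (1 + norm x ^ 1)"
    using uniform_growth_bound[of I 1 "\<lambda>p. pdx (fst p) (\<lambda>x t. a x t $ fst p $ snd p)" ?K] assms(9) KI a(2) by auto
  have "continuous_on (UNIV \<times> ?K) (\<lambda>z. \<chi> i. b (fst z) (snd z) $ i)"
    by (intro continuous_on_vec_lambda b)
  then obtain C3 where C3: "0 \<le> C3" "\<And>x \<tau>. \<tau> \<in> ?K \<Longrightarrow> norm (b x \<tau>) \<le> C3 * (1 + norm x ^ 1)"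
    using growth_O_bound[OF assms(11), of ?K] KI by auto
  let ?C = "C1 + C2 + C3"
  interpret parabolic_solution a b c u "pdt I u" q s t ?C
  proof
    show "s \<le> t" "2 \<le> q" by fact+
    show "0 \<le> ?C" using C1(1) C2(1) C3(1) by simp
    \<comment> \<open>Integrability is given for the completed measure on all of \<open>I\<close>; the restriction to \<open>[s, t]\<close> is Borel, so it is integrable for \<open>lborel\<close> as well.\<close>
    show "integrable lborel (\<lambda>z. indicator ?K (snd z) * \<bar>u (fst z) (snd z)\<bar> powr q)"
    proof -
      have "(UNIV :: (real^'n) set) \<times> I \<in> sets borel"
        using real_interval_borel_measurable[OF assms(1)] by (intro borel_Times) auto
      then have strip: "(UNIV :: (real^'n) set) \<times> I \<inter> space lebesgue \<in> sets lebesgue"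
        by simp
      have "integrable (lebesgue_on (UNIV \<times> I)) (\<lambda>z. \<bar>case z of (x, t) \<Rightarrow> u x t\<bar> powr q)"
        using assms(15) by (simp add: in_Lp_def)
      then have int: "integrable lebesgue (\<lambda>z. indicator (UNIV \<times> I) z *\<^sub>R \<bar>case z of (x, t) \<Rightarrow> u x t\<bar> powr q)"
        by (rule integrable_restrict_space[THEN iffD1, OF strip])
      have meas: "(\<lambda>z. indicator ?K (snd z) * \<bar>u (fst z) (snd z)\<bar> powr q) \<in> borel_measurable borel"
        using assms(14) by (intro measurable_strip continuous_on_powr' continuous_on_rabs u continuous_on_const) auto
      have "integrable lebesgue (\<lambda>z. indicator ?K (snd z) * \<bar>u (fst z) (snd z)\<bar> powr q)"
      proof (rule Bochner_Integration.integrable_bound[OF int])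
        show "(\<lambda>z. indicator ?K (snd z) * \<bar>u (fst z) (snd z)\<bar> powr q) \<in> borel_measurable lebesgue"
          using meas by (intro measurable_completion) simp
      qed (use KI in \<open>auto simp: indicator_def intro!: AE_I2\<close>)
      then show ?thesis
        using meas by (simp add: integrable_completion)
    qed
  next
    fix x :: "real^'n" and \<tau> and \<xi> :: "'n \<Rightarrow> real" assume "\<tau> \<in> ?K"
    then have "\<exists>\<theta>>0. (\<Sum>i\<in>UNIV. \<Sum>j\<in>UNIV. a x \<tau> $ i $ j * (\<chi> i. \<xi> i) $ i * (\<chi> i. \<xi> i) $ j) \<ge> \<theta> * (norm (\<chi> i. \<xi> i))\<^sup>2"
      using assms(7) KI by blast
    then show "0 \<le> (\<Sum>i\<in>UNIV. \<Sum>j\<in>UNIV. a x \<tau> $ i $ j * \<xi> i * \<xi> j)"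
      by (auto elim!: order_trans[rotated])
  next
    fix x \<tau> assume \<tau>: "\<tau> \<in> ?K"
    have "pdx i (\<lambda>x t. a x t $ i $ j * pdx j u x t) x \<tau>
        = pdx i (\<lambda>x t. a x t $ i $ j) x \<tau> * pdx j u x \<tau> + a x \<tau> $ i $ j * pdx i (pdx j u) x \<tau>" for i j
      by (intro pdx_eqI has_partial_mult a u \<tau>)
    then show "pdt I u x \<tau>
      - (\<Sum>i\<in>UNIV. \<Sum>j\<in>UNIV. pdx i (\<lambda>x t. a x t $ i $ j) x \<tau> * pdx j u x \<tau> + a x \<tau> $ i $ j * pdx i (pdx j u) x \<tau>)
      + (\<Sum>i\<in>UNIV. b x \<tau> $ i * pdx i u x \<tau>) + c x \<tau> * u x \<tau> = 0"
      using assms(13)[of \<tau> x] KI \<tau> by (auto simp: inner_vec_def grad_def)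
  next
    fix i j x \<tau> assume \<tau>: "\<tau> \<in> ?K"
    have "\<bar>a x \<tau> $ i $ j\<bar> \<le> C1 * (1 + (norm x)\<^sup>2)"
      using C1(2)[OF \<tau>, of x "(i, j)"] by simp
    also have "\<dots> \<le> ?C * (1 + (norm x)\<^sup>2)"
      using C2(1) C3(1) by (intro mult_right_mono) auto
    finally show "\<bar>a x \<tau> $ i $ j\<bar> \<le> ?C * (1 + (norm x)\<^sup>2)" .
    have "\<bar>pdx i (\<lambda>x t. a x t $ i $ j) x \<tau>\<bar> \<le> C2 * (1 + norm x)"
      using C2(2)[OF \<tau>, of "(i, j)" x] by simp
    also have "\<dots> \<le> ?C * (1 + norm x)"
      using C1(1) C3(1) by (intro mult_right_mono) auto
    finally show "\<bar>pdx i (\<lambda>x t. a x t $ i $ j) x \<tau>\<bar> \<le> ?C * (1 + norm x)" .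
    have "\<bar>b x \<tau> $ i\<bar> \<le> C3 * (1 + norm x)"
      using C3(2)[OF \<tau>, of x] component_le_norm_cart[of "b x \<tau>" i] by simp
    also have "\<dots> \<le> ?C * (1 + norm x)"
      using C1(1) C2(1) by (intro mult_right_mono) auto
    finally show "\<bar>b x \<tau> $ i\<bar> \<le> ?C * (1 + norm x)" .
  qed (use assms(6) KI in blast, (rule a b u time; assumption)+)
  show ?thesis
    using extended_energy_identity finite_energy_identity by blast
qed

end
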